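(* Let $x^*$ be any feasible solution of the LP described in the context. Then there exist spanning trees $S_1,\ldots,S_r\in\mathcal{S}$ and numbers $p_1,\ldots,p_r>0$ with $\sum_{j=1}^r p_j=1$ such that $x^*=\sum_{j=1}^r p_j\chi^{S_j}$ and such that for every narrow cut $C\in\mathcal{C}$ there exists $k\in\{1,\ldots,r\}$ with $\sum_{j=1}^k p_j\ge 2-x^*(C)$ and $|C\cap S_j|=1$ for all $j=1,\ldots,k$.
   Context: $V$ is a finite set, $s,t\in V$ with $s\neq t$, and $E$ is the edge set of the complete graph on $V$. For $U\subseteq V$, $\delta(U)$ is the set of edges with exactly one endpoint in $U$, and $\delta(v):=\delta(\{v\})$. For $x\in\mathbb{R}^E$ and $F\subseteq E$, $x(F):=\sum_{e\in F}x_e$; $\chi^F\in\{0,1\}^E$ is the characteristic vector of $F$. The LP has variables $x\in\mathbb{R}^E$ and constraints: $x(\delta(U))\ge 2$ for all $\emptyset\ne U\subsetneq V$ with $|U\cap\{s,t\}|$ even; $x(\delta(U))\ge 1$ for all $\emptyset\ne U\subsetneq V$ with $|U\cap\{s,t\}|$ odd; $x(\delta(v))=2$ for $v\in V\setminus\{s,t\}$; $x(\delta(v))=1$ for $v\in\{s,t\}$; $x_e\ge 0$ for $e\in E$ (the objective, minimizing $\sum_e c_e x_e$ for a given metric $c$, is irrelevant here). $\mathcal{S}$ denotes the set of edge sets of spanning trees of $(V,E)$. A narrow cut (with respect to $x^*$) is a set $C=\delta(U)$, $\emptyset\neq U\subsetneq V$, with $x^*(C)<2$; $\mathcal{C}$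 is the set of narrow cuts. *)

theory Defs
  imports Complex_Main "HOL-Library.Indicator_Function"
begin

text \<open>
  An undirected edge is a two-element set of vertices. A vector in \<open>\<real>\<^sup>E\<close> is a function
  on vertex sets of which only the values on \<open>E\<close> are ever used, and \<open>x(F)\<close> is \<^term>\<open>sum x F\<close>.
\<close>

definition complete_edges :: "'a set \<Rightarrow> 'a set set" where
  "complete_edges V = {e. e \<subseteq> V \<and> card e = 2}"

definition cut :: "'a set \<Rightarrow> 'a set \<Rightarrow> 'a set set" where
  "cut V U = {e \<in> complete_edges V. card (e \<inter> U) = 1}"

definition lp_feasible :: "'a set \<Rightarrow> 'a \<Rightarrow> 'a \<Rightarrow> ('a set \<Rightarrow> real) \<Rightarrow> bool" where
  "lp_feasible V s t x \<longleftrightarrow>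
     (\<forall>U. U \<noteq> {} \<and> U \<subset> V \<and> even (card (U \<inter> {s, t})) \<longrightarrow> sum x (cut V U) \<ge> 2) \<and>
     (\<forall>U. U \<noteq> {} \<and> U \<subset> V \<and> odd (card (U \<inter> {s, t})) \<longrightarrow> sum x (cut V U) \<ge> 1) \<and>
     (\<forall>v \<in> V - {s, t}. sum x (cut V {v}) = 2) \<and>
     (\<forall>v \<in> {s, t}. sum x (cut V {v}) = 1) \<and>
     (\<forall>e \<in> complete_edges V. x e \<ge> 0)"

definition narrow_cuts :: "'a set \<Rightarrow> ('a set \<Rightarrow> real) \<Rightarrow> 'a set set set" where
  "narrow_cuts V x = {cut V U | U. U \<noteq> {} \<and> U \<subset> V \<and> sum x (cut V U) < 2}"

definition graph_connected :: "'a set \<Rightarrow> 'a set set \<Rightarrow> bool" where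
  "graph_connected V F \<longleftrightarrow> (\<forall>u \<in> V. \<forall>v \<in> V. (u, v) \<in> {(a, b). {a, b} \<in> F}\<^sup>*)"

text \<open>A cycle is the list of its vertices in cyclic order, without repeating the first one.\<close>

definition graph_cycle :: "'a set set \<Rightarrow> 'a list \<Rightarrow> bool" where
  "graph_cycle F vs \<longleftrightarrow> length vs \<ge> 3 \<and> distinct vs \<and>
     (\<forall>i < length vs. {vs ! i, vs ! (Suc i mod length vs)} \<in> F)"

text \<open>
  Trees of \<^emph>\<open>Graph_Theory\<close> exclude directed cycles only, so they do not model undirected trees.
\<close>

definition spanning_trees :: "'a set \<Rightarrow> 'a set set set" where
  "spanning_trees V =
     {F. F \<subseteq> complete_edges V \<and> graph_connected V F \<and> \<not> (\<exists>vs. graph_cycle F vs)}"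

end

theory Submission
  imports Defs "HOL-Analysis.Analysis"
begin

text \<open>
  The sides containing \<open>s\<close> of the narrow cuts form a chain. Let \<open>\<lambda>\<close> be the least \<open>2 - x(\<delta>(X))\<close> over
  this chain. It suffices to write \<open>x = \<lambda> y + (1 - \<lambda>) z\<close> with \<open>y\<close> a convex combination of trees that
  cross every cut of the chain exactly once and \<open>z\<close> any convex combination of spanning trees: then
  \<open>z\<close> satisfies the same hypotheses for the shorter chain of the cuts with \<open>2 - x(\<delta>(X)) > \<lambda>\<close>, and
  one recurses. By linear programming duality and the greedy algorithm, such a splitting exists if
  \<open>x(A) \<le> \<lambda> r\<^sub>1(A) + (1 - \<lambda>) r\<^sub>2(A)\<close> for all edge sets \<open>A\<close>, where \<open>r\<^sub>1\<close> and \<open>r\<^sub>2\<close> are the rank functions of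
  the two matroids whose bases are these trees.

  Call two vertices level if no set of the chain separates them. To prove the rank inequality, first
  add to \<open>A\<close> all edges inside a difference \<open>R\<close> of two sets of the chain as long as two level
  vertices (or two vertices separated by one set that no edge of \<open>A\<close> crosses alone) are joined by \<open>A\<close>
  but not by its level edges; since \<open>x(E[R]) \<ge> \<bar>R\<bar> - 2 + \<lambda>\<close>, the inequality only becomes tighter. Then
  delete from \<open>A\<close> the edges crossing one cut, of total weight at most \<open>2 - \<lambda>\<close>, if this creates at
  least two new components, and those crossing two given cuts, of total weight at most \<open>1 - \<lambda>\<close>, if it
  creates one. When neither is possible, \<open>r\<^sub>2(A) \<le> r\<^sub>1(A)\<close>, and \<open>x(A) \<le> r\<^sub>2(A)\<close> finishes the proof.
\<close>

section \<open>Connected components and spanning trees\<close>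

definition conn :: "'a set set \<Rightarrow> ('a \<times> 'a) set" where
  "conn F = {(a, b). {a, b} \<in> F}\<^sup>*"

definition comp_of :: "'a set set \<Rightarrow> 'a \<Rightarrow> 'a set" where
  "comp_of F v = {w. (v, w) \<in> conn F}"

definition ncomp :: "'a set \<Rightarrow> 'a set set \<Rightarrow> nat" where
  "ncomp V F = card (comp_of F ` V)"

lemma conn_refl [simp]: "(a, a) \<in> conn F"
  by (simp add: conn_def)

lemma conn_edge: "{a, b} \<in> F \<Longrightarrow> (a, b) \<in> conn F"
  unfolding conn_def by auto

lemma conn_sym: "(a, b) \<in> conn F \<Longrightarrow> (b, a) \<in> conn F"
proof -
  have "sym {(a, b). {a, b} \<in> F}" by (auto simp: sym_def insert_commute)
  then show "(a, b) \<in> conn F \<Longrightarrow> (b, a) \<in> conn F"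
    unfolding conn_def using sym_rtrancl symD by metis
qed

lemma conn_trans: "(a, b) \<in> conn F \<Longrightarrow> (b, c) \<in> conn F \<Longrightarrow> (a, c) \<in> conn F"
  unfolding conn_def by (rule rtrancl_trans)

lemma conn_subset:
  assumes "\<And>a b. {a, b} \<in> F \<Longrightarrow> (a, b) \<in> conn G" "(u, v) \<in> conn F"
  shows "(u, v) \<in> conn G"
proof -
  have "{(a, b). {a, b} \<in> F} \<subseteq> conn G" using assms(1) by auto
  then have "conn F \<subseteq> (conn G)\<^sup>*" unfolding conn_def[of F] by (rule rtrancl_mono)
  then show ?thesis using assms(2) by (auto simp: conn_def)
qed

lemma conn_mono: "F \<subseteq> G \<Longrightarrow> (u, v) \<in> conn F \<Longrightarrow> (u, v) \<in> conn G"
  by (rule conn_subset) (auto intro: conn_edge)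

lemma conn_invariant:
  assumes "(u, v) \<in> conn F" "P u" "\<And>a b. {a, b} \<in> F \<Longrightarrow> P a \<Longrightarrow> P b"
  shows "P v"
  using assms(1) unfolding conn_def
  by (induction rule: rtrancl_induct) (use assms(2,3) in auto)

text \<open>The vertices satisfying \<open>P\<close> that are reachable from \<open>u\<close> cannot
  be closed under the edges of \<open>F\<close>, which yields the exit edge; the last conclusion
  holds because everything takes place in one component.\<close>

lemma conn_leaves:
  assumes "(u, v) \<in> conn F" "P u" "\<not> P v"
  obtains a b where "{a, b} \<in> F" "P a" "\<not> P b" "(u, a) \<in> conn F" "(b, v) \<in> conn F"
proof -
  have "\<exists>a b. {a, b} \<in> F \<and> P a \<and> \<not> P b \<and> (u, a) \<in> conn F"
  proof (rule ccontr)
    assume neg: "\<not> ?thesis"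
    have "P v \<and> (u, v) \<in> conn F"
      using assms(1) by (rule conn_invariant[where P = "\<lambda>z. P z \<and> (u, z) \<in> conn F"])
        (use assms(2) neg in \<open>blast intro: conn_trans conn_edge conn_refl\<close>)+
    with assms(3) show False by simp
  qed
  then obtain a b where ab: "{a, b} \<in> F" "P a" "\<not> P b" "(u, a) \<in> conn F" by auto
  moreover have "(b, v) \<in> conn F"
    using ab(1,4) assms(1) by (meson conn_edge conn_sym conn_trans)
  ultimately show ?thesis using that by blast
qed

lemma conn_insert:
  assumes "(a, b) \<in> conn (insert {u, v} F)"
  shows "(a, b) \<in> conn F \<or> (a, u) \<in> conn F \<and> (v, b) \<in> conn F
    \<or> (a, v) \<in> conn F \<and> (u, b) \<in> conn F"
  using assms
proof (rule conn_invariant)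
  fix c d
  assume cd: "{c, d} \<in> insert {u, v} F"
    and c: "(a, c) \<in> conn F \<or> (a, u) \<in> conn F \<and> (v, c) \<in> conn F
      \<or> (a, v) \<in> conn F \<and> (u, c) \<in> conn F"
  show "(a, d) \<in> conn F \<or> (a, u) \<in> conn F \<and> (v, d) \<in> conn F
    \<or> (a, v) \<in> conn F \<and> (u, d) \<in> conn F"
  proof (cases "{c, d} \<in> F")
    case True
    then show ?thesis using c conn_trans conn_edge by metis
  next
    case False
    then have "c = u \<and> d = v \<or> c = v \<and> d = u" using cd by (auto simp: doubleton_eq_iff)
    then show ?thesis using c conn_refl conn_trans conn_sym by metis
  qed
qed simp

lemma comp_of_eq_iff: "comp_of F u = comp_of F v \<longleftrightarrow> (u, v) \<in> conn F"
proof
  assume "comp_of F u = comp_of F v"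
  then have "v \<in> comp_of F u" by (simp add: comp_of_def)
  then show "(u, v) \<in> conn F" by (simp add: comp_of_def)
next
  assume "(u, v) \<in> conn F"
  then have "(u, w) \<in> conn F \<longleftrightarrow> (v, w) \<in> conn F" for w
    using conn_sym conn_trans by metis
  then show "comp_of F u = comp_of F v" by (simp add: comp_of_def)
qed

lemma comp_of_self [simp]: "v \<in> comp_of F v"
  by (simp add: comp_of_def)

lemma in_comp_of: "w \<in> comp_of F v \<longleftrightarrow> (v, w) \<in> conn F"
  by (simp add: comp_of_def)

lemma ncomp_cong:
  assumes "\<And>u v. u \<in> V \<Longrightarrow> (u, v) \<in> conn F \<longleftrightarrow> (u, v) \<in> conn G"
  shows "ncomp V F = ncomp V G"
proof -
  have "comp_of F v = comp_of G v" if "v \<in> V" for v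
    using assms that by (auto simp: comp_of_def)
  then show ?thesis by (simp add: ncomp_def)
qed

text \<open>The component of a vertex in \<open>G\<close> is a function of its component in
  \<open>F\<close>, so \<open>G\<close> cannot have more of them.\<close>

lemma ncomp_antimono_conn:
  assumes "finite V" "\<And>u v. u \<in> V \<Longrightarrow> v \<in> V \<Longrightarrow> (u, v) \<in> conn F \<Longrightarrow> (u, v) \<in> conn G"
  shows "ncomp V G \<le> ncomp V F"
proof -
  define g where "g K = comp_of G (SOME v. v \<in> V \<and> comp_of F v = K)" for K
  have "comp_of G v = g (comp_of F v)" if "v \<in> V" for v
  proof -
    define w where "w = (SOME w. w \<in> V \<and> comp_of F w = comp_of F v)"
    have "w \<in> V \<and> comp_of F w = comp_of F v"
      unfolding w_def by (rule someI[of _ v]) (use that in auto)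
    then have "(w, v) \<in> conn G" using assms(2) that by (auto simp: comp_of_eq_iff)
    then have "comp_of G w = comp_of G v" by (simp add: comp_of_eq_iff)
    then show ?thesis by (simp add: g_def w_def)
  qed
  then have "comp_of G ` V = g ` (comp_of F ` V)" by (auto simp: image_image)
  then show ?thesis unfolding ncomp_def using assms(1) by (simp add: card_image_le)
qed

lemma ncomp_antimono: "finite V \<Longrightarrow> F \<subseteq> G \<Longrightarrow> ncomp V G \<le> ncomp V F"
  by (rule ncomp_antimono_conn) (auto intro: conn_mono)

lemma ncomp_insert_conn:
  assumes "(u, v) \<in> conn F"
  shows "ncomp V (insert {u, v} F) = ncomp V F"
proof (rule ncomp_cong)
  fix a b
  show "(a, b) \<in> conn (insert {u, v} F) \<longleftrightarrow> (a, b) \<in> conn F"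
    using conn_insert[of a b u v F] assms
    by (meson conn_mono conn_sym conn_trans subset_insertI)
qed

text \<open>The components of \<open>u\<close> and \<open>v\<close> merge into one and all others
  remain.\<close>

lemma ncomp_insert_not_conn:
  assumes "finite V" "u \<in> V" "v \<in> V" "(u, v) \<notin> conn F"
  shows "ncomp V F = ncomp V (insert {u, v} F) + 1"
proof -
  let ?G = "insert {u, v} F" and ?C = "comp_of F ` V"
  let ?u = "comp_of F u" and ?v = "comp_of F v"
  have ne: "?u \<noteq> ?v" using assms(4) by (simp add: comp_of_eq_iff)
  have uvG: "(u, v) \<in> conn ?G" by (simp add: conn_edge)
  have FG: "(a, b) \<in> conn F \<Longrightarrow> (a, b) \<in> conn ?G" for a b
    by (erule conn_mono[rotated]) auto
  have 1: "comp_of ?G w = ?u \<union> ?v" if "w \<in> ?u \<union> ?v" for w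
  proof -
    have "(u, w) \<in> conn ?G" using that FG uvG conn_trans unfolding in_comp_of Un_iff by metis
    then have "comp_of ?G w = comp_of ?G u" by (metis comp_of_eq_iff)
    also have "\<dots> = ?u \<union> ?v"
    proof (intro equalityI subsetI)
      fix z assume "z \<in> comp_of ?G u"
      then show "z \<in> ?u \<union> ?v"
        using conn_insert[of u z u v F] assms(4) by (auto simp: in_comp_of)
    next
      fix z assume "z \<in> ?u \<union> ?v"
      then show "z \<in> comp_of ?G u"
        using FG uvG conn_trans unfolding in_comp_of Un_iff by metis
    qed
    finally show ?thesis .
  qed
  have 2: "comp_of ?G w = comp_of F w" if "w \<notin> ?u \<union> ?v" for w
  proof -
    have "(w, u) \<notin> conn F" "(w, v) \<notin> conn F"
      using that conn_sym unfolding in_comp_of Un_iff by metis+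
    then show ?thesis using conn_insert[of w _ u v F] FG by (auto simp: in_comp_of)
  qed
  have "comp_of ?G ` V = insert (?u \<union> ?v) (?C - {?u, ?v})"
  proof (intro equalityI subsetI)
    fix K assume "K \<in> comp_of ?G ` V"
    then obtain w where w: "w \<in> V" "K = comp_of ?G w" by auto
    show "K \<in> insert (?u \<union> ?v) (?C - {?u, ?v})"
    proof (cases "w \<in> ?u \<union> ?v")
      case True
      then show ?thesis using 1[OF True] w by simp
    next
      case False
      then have "comp_of F w \<noteq> ?u" "comp_of F w \<noteq> ?v" using comp_of_self[of w F] by auto
      then show ?thesis using 2[OF False] w by simp
    qed
  next
    fix K assume "K \<in> insert (?u \<union> ?v) (?C - {?u, ?v})"
    then consider "K = ?u \<union> ?v" | w where "w \<in> V" "K = comp_of F w" "K \<noteq> ?u" "K \<noteq> ?v" by auto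
    then show "K \<in> comp_of ?G ` V"
    proof cases
      case 1
      then show ?thesis using \<open>\<And>w. w \<in> ?u \<union> ?v \<Longrightarrow> comp_of ?G w = ?u \<union> ?v\<close>[of u] assms(2) by auto
    next
      case (2 w)
      then have "w \<notin> ?u \<union> ?v" using comp_of_eq_iff in_comp_of by (metis Un_iff)
      then show ?thesis using \<open>\<And>w. w \<notin> ?u \<union> ?v \<Longrightarrow> comp_of ?G w = comp_of F w\<close>[of w] 2 by auto
    qed
  qed
  moreover have "?u \<union> ?v \<notin> ?C - {?u, ?v}"
  proof
    assume "?u \<union> ?v \<in> ?C - {?u, ?v}"
    then obtain w where w: "?u \<union> ?v = comp_of F w" by auto
    then have "(w, u) \<in> conn F" "(w, v) \<in> conn F" by (metis Un_iff comp_of_self in_comp_of)+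
    then show False using assms(4) conn_sym conn_trans by metis
  qed
  ultimately have "ncomp V ?G = Suc (card (?C - {?u, ?v}))"
    using assms(1) by (simp add: ncomp_def)
  moreover have "card (?C - {?u, ?v}) = card ?C - 2"
    using ne assms by (subst card_Diff_subset) auto
  moreover have "card ?C \<ge> 2"
    using ne assms card_mono[of ?C "{?u, ?v}"] by auto
  ultimately show ?thesis by (simp add: ncomp_def)
qed

lemma conn_empty [simp]: "conn {} = Id"
  by (simp add: conn_def)

lemma ncomp_empty: "ncomp V {} = card V"
proof -
  have "inj_on (comp_of {}) V" by (auto simp: inj_on_def comp_of_def)
  then show ?thesis by (simp add: ncomp_def card_image)
qed

section \<open>Edge sets of the complete graph and component counts\<close>

lemma complete_edges_iff: "{a, b} \<in> complete_edges V \<longleftrightarrow> a \<in> V \<and> b \<in> V \<and> a \<noteq> b"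
  by (auto simp: complete_edges_def card_insert_if)

lemma complete_edgesE:
  assumes "e \<in> complete_edges V"
  obtains a b where "e = {a, b}" "a \<in> V" "b \<in> V" "a \<noteq> b"
  using assms by (auto simp: complete_edges_def card_2_iff)

lemma finite_complete_edges: "finite V \<Longrightarrow> finite (complete_edges V)"
  by (rule finite_subset[of _ "Pow V"]) (auto simp: complete_edges_def)

lemma complete_edges_mono: "U \<subseteq> V \<Longrightarrow> complete_edges U \<subseteq> complete_edges V"
  by (auto simp: complete_edges_def)

lemma ncomp_Un_ge:
  assumes "finite V" "finite D" "D \<subseteq> complete_edges V"
  shows "ncomp V F \<le> ncomp V (F \<union> D) + card D"
  using assms(2,3)
proof (induction D rule: finite_induct)
  case (insert e D)
  then obtain a b where e: "e = {a, b}" "a \<in> V" "b \<in> V" by (auto elim: complete_edgesE)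
  have "ncomp V (F \<union> D) \<le> ncomp V (F \<union> insert e D) + 1"
    using ncomp_insert_conn[of a b "F \<union> D" V] ncomp_insert_not_conn[of V a b "F \<union> D"] assms(1) e
    by (cases "(a, b) \<in> conn (F \<union> D)") auto
  then show ?case using insert by auto
qed simp

lemma conn_in_V:
  assumes "F \<subseteq> complete_edges V" "(u, v) \<in> conn F" "u \<in> V"
  shows "v \<in> V"
  using assms(2,3)
proof (rule conn_invariant)
  fix a b assume "{a, b} \<in> F"
  then have "{a, b} \<in> complete_edges V" using assms(1) by blast
  then show "b \<in> V" by (simp add: complete_edges_iff)
qed

lemma ncomp_eq_1:
  assumes "V \<noteq> {}" "\<And>u v. u \<in> V \<Longrightarrow> v \<in> V \<Longrightarrow> (u, v) \<in> conn F"
  shows "ncomp V F = 1"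
proof -
  obtain u where u: "u \<in> V" using assms(1) by auto
  have "comp_of F ` V = {comp_of F u}"
  proof -
    have "comp_of F v = comp_of F u" if "v \<in> V" for v
      using u assms(2) that by (simp add: comp_of_eq_iff)
    then show ?thesis using u by (metis image_cong image_constant)
  qed
  then show ?thesis by (simp add: ncomp_def)
qed

text \<open>The components that miss \<open>R\<close> survive, and the new component of a vertex of
  \<open>R\<close> comes on top of them. The form without subtraction keeps the count in the natural
  numbers.\<close>

lemma ncomp_Un_complete_ge:
  assumes "finite V" "R \<subseteq> V" "R \<noteq> {}"
  shows "ncomp V F + 1 \<le> ncomp V (F \<union> complete_edges R) + card (comp_of F ` R)"
proof -
  let ?G = "F \<union> complete_edges R"
  let ?N = "comp_of F ` V - comp_of F ` R"
  obtain r where r: "r \<in> R" using assms(3) by auto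
  have 1: "comp_of ?G v = comp_of F v" if "v \<in> V" "comp_of F v \<notin> comp_of F ` R" for v
  proof -
    have "(v, w) \<in> conn F" if "(v, w) \<in> conn ?G" for w
      using that
    proof (rule conn_invariant)
      fix a b assume "{a, b} \<in> ?G" "(v, a) \<in> conn F"
      moreover have "a \<notin> R"
        using \<open>comp_of F v \<notin> comp_of F ` R\<close> \<open>(v, a) \<in> conn F\<close> by (auto simp: image_iff comp_of_eq_iff)
      ultimately have "{a, b} \<in> F" by (auto simp: complete_edges_iff)
      with \<open>(v, a) \<in> conn F\<close> show "(v, b) \<in> conn F"
        using conn_trans conn_edge by metis
    qed simp
    then show ?thesis by (auto simp: in_comp_of intro: conn_mono[of F ?G])
  qed
  have "insert (comp_of ?G r) ?N \<subseteq> comp_of ?G ` V"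
  proof (intro insert_subsetI subsetI)
    fix K assume "K \<in> ?N"
    then obtain v where "v \<in> V" "K = comp_of F v" "comp_of F v \<notin> comp_of F ` R" by auto
    with 1 show "K \<in> comp_of ?G ` V" by (metis imageI)
  qed (use r assms in auto)
  moreover have "comp_of ?G r \<notin> ?N"
  proof
    assume "comp_of ?G r \<in> ?N"
    then obtain v where v: "comp_of ?G r = comp_of F v" "comp_of F v \<notin> comp_of F ` R" by auto
    then have "(v, r) \<in> conn F" by (metis comp_of_self in_comp_of)
    then show False using v r by (metis comp_of_eq_iff imageI)
  qed
  ultimately have "Suc (card ?N) \<le> ncomp V ?G"
    using assms(1) by (metis card_insert_disjoint card_mono finite_Diff finite_imageI ncomp_def)
  moreover have "card ?N = ncomp V F - card (comp_of F ` R)"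
    using assms by (simp add: ncomp_def card_Diff_subset image_mono finite_subset)
  moreover have "card (comp_of F ` R) \<le> ncomp V F"
    using assms by (simp add: ncomp_def card_mono image_mono)
  ultimately show ?thesis by linarith
qed

text \<open>Connectedness with the right number of edges replaces acyclicity, because the rank
  arguments count edges; \<open>is_tree_imp_spanning_tree\<close> recovers the absence of
  cycles.\<close>

definition is_tree :: "'a set \<Rightarrow> 'a set set \<Rightarrow> bool" where
  "is_tree V T \<longleftrightarrow> T \<subseteq> complete_edges V \<and> (\<forall>u\<in>V. \<forall>v\<in>V. (u, v) \<in> conn T) \<and> card T + 1 = card V"

lemma is_tree_finite: "is_tree V T \<Longrightarrow> finite V \<Longrightarrow> finite T"
  unfolding is_tree_def using finite_complete_edges finite_subset by blast

text \<open>An edge lowers the number of components by at most one, and the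
  \<open>card V - 1\<close> edges of \<open>T\<close> have to lower it from \<open>card V\<close> to
  1, so none of them is wasted. Subsets of trees are thus independent in the graphic
  matroid.\<close>

lemma tree_ncomp:
  assumes "finite V" "is_tree V T" "F \<subseteq> T"
  shows "ncomp V F + card F = card V"
proof -
  have fT: "finite T" using is_tree_finite assms by blast
  have fF: "finite F" using fT assms(3) finite_subset by blast
  have T: "T \<subseteq> complete_edges V" using assms(2) by (simp add: is_tree_def)
  have cV: "card T + 1 = card V" using assms(2) by (simp add: is_tree_def)
  then have "V \<noteq> {}" by auto
  then have "ncomp V T = 1" using assms(2) by (intro ncomp_eq_1) (auto simp: is_tree_def)
  moreover have "ncomp V F \<le> ncomp V (F \<union> (T - F)) + card (T - F)"
    using ncomp_Un_ge[of V "T - F" F] assms fT T by auto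
  moreover have "F \<union> (T - F) = T" using assms(3) by auto
  moreover have "card (T - F) = card T - card F" "card F \<le> card T"
    using assms(3) fT fF by (auto simp: card_Diff_subset card_mono)
  moreover have "ncomp V {} \<le> ncomp V ({} \<union> F) + card F"
    using ncomp_Un_ge[of V F "{}"] assms fF T by auto
  ultimately show ?thesis using cV by (simp add: ncomp_empty)
qed

lemma is_treeI:
  assumes "finite V" "V \<noteq> {}" "T \<subseteq> complete_edges V" "card T + 1 \<le> card V"
    "\<And>u v. u \<in> V \<Longrightarrow> v \<in> V \<Longrightarrow> (u, v) \<in> conn T"
  shows "is_tree V T"
proof -
  have "finite T" using assms finite_complete_edges finite_subset by blast
  then have "ncomp V {} \<le> ncomp V ({} \<union> T) + card T"
    using ncomp_Un_ge[of V T "{}"] assms by auto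
  moreover have "ncomp V T = 1" using assms by (intro ncomp_eq_1) auto
  ultimately show ?thesis using assms by (auto simp: is_tree_def ncomp_empty)
qed

text \<open>In a minimal part of \<open>F\<close> that joins \<open>u\<close> to \<open>v\<close>,
  every edge can be replaced by \<open>{u, v}\<close>; some edge of this part is missing from
  \<open>G\<close>, since \<open>G\<close> does not join them.\<close>

lemma tree_exchange:
  assumes "finite V" "is_tree V T" "F \<subseteq> T" "u \<in> V" "v \<in> V" "u \<noteq> v"
    "(u, v) \<in> conn F" "(u, v) \<notin> conn G"
  obtains f where "f \<in> F" "f \<notin> G" "is_tree V (insert {u, v} (T - {f}))"
proof -
  have fT: "finite T" using is_tree_finite assms by blast
  then have "finite F" using assms(3) finite_subset by blast
  then have "\<exists>F'. F' \<subseteq> F \<and> (u, v) \<in> conn F' \<and> (\<forall>H. H \<subset> F' \<longrightarrow> (u, v) \<notin> conn H)"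
    using assms(7)
  proof (induction F rule: finite_psubset_induct)
    case (psubset F)
    show ?case
    proof (cases "\<exists>H. H \<subset> F \<and> (u, v) \<in> conn H")
      case True
      then obtain H where H: "H \<subset> F" "(u, v) \<in> conn H" by auto
      obtain F' where "F' \<subseteq> H" "(u, v) \<in> conn F'" "\<forall>J. J \<subset> F' \<longrightarrow> (u, v) \<notin> conn J"
        using psubset.IH[OF H] by auto
      then show ?thesis using H(1) by (intro exI[of _ F']) auto
    next
      case False
      then show ?thesis using psubset.prems by (intro exI[of _ F]) auto
    qed
  qed
  then obtain F' where F': "F' \<subseteq> F" "(u, v) \<in> conn F'" "\<And>H. H \<subset> F' \<Longrightarrow> (u, v) \<notin> conn H"
    by blast
  have "\<not> F' \<subseteq> G" using F'(2) assms(8) conn_mono by metis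
  then obtain f where f: "f \<in> F'" "f \<notin> G" by auto
  have TE: "T \<subseteq> complete_edges V" using assms(2) by (simp add: is_tree_def)
  have fT': "f \<in> T" using f F' assms(3) by auto
  then have "f \<in> complete_edges V" using TE by auto
  then obtain a b where ab: "f = {a, b}" by (rule complete_edgesE)
  let ?H = "F' - {f}" and ?T = "insert {u, v} (T - {f})"
  have "(u, v) \<notin> conn ?H" using F'(3)[of ?H] f by auto
  moreover have "insert {a, b} ?H = F'" using f ab by auto
  ultimately have "(u, a) \<in> conn ?H \<and> (b, v) \<in> conn ?H \<or> (u, b) \<in> conn ?H \<and> (a, v) \<in> conn ?H"
    using conn_insert[of u v a b ?H] F'(2) by auto
  moreover have HT: "(p, q) \<in> conn ?H \<Longrightarrow> (p, q) \<in> conn ?T" for p q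
    by (erule conn_mono[rotated]) (use F' assms(3) in auto)
  moreover have "(u, v) \<in> conn ?T" by (simp add: conn_edge)
  ultimately have abT: "(a, b) \<in> conn ?T" by (meson conn_sym conn_trans)
  have "is_tree V ?T"
  proof (rule is_treeI)
    show "card ?T + 1 \<le> card V"
    proof -
      have "card ?T \<le> Suc (card (T - {f}))" using fT by (simp add: card_insert_if)
      also have "\<dots> = card T" using fT fT' by (rule card_Suc_Diff1)
      finally show ?thesis using assms(2) by (simp add: is_tree_def)
    qed
    show "(p, q) \<in> conn ?T" if "p \<in> V" "q \<in> V" for p q
    proof (rule conn_subset)
      show "(p, q) \<in> conn T" using that assms(2) by (auto simp: is_tree_def)
      fix c d assume "{c, d} \<in> T"
      then show "(c, d) \<in> conn ?T"
        using abT ab by (cases "{c, d} = f") (auto simp: doubleton_eq_iff intro: conn_edge conn_sym)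
    qed
  qed (use assms TE in \<open>auto simp: complete_edges_iff\<close>)
  then show ?thesis using that f F' by blast
qed

text \<open>This is the greedy property: if the cheap edges of \<open>T\<close> did not join the
  ends of an edge of cost at most \<open>g\<close>, exchanging a costlier tree edge for this edge
  would lower the total cost.\<close>

lemma min_cost_tree_conn:
  fixes c :: "'a set \<Rightarrow> real"
  assumes "finite V" "is_tree V T"
    and min: "\<And>T'. is_tree V T' \<Longrightarrow> sum c T \<le> sum c T'"
    and "(u, v) \<in> conn {e \<in> complete_edges V. c e \<le> g}"
  shows "(u, v) \<in> conn {e \<in> T. c e \<le> g}"
  using assms(4)
proof (rule conn_subset[rotated])
  fix a b assume ab: "{a, b} \<in> {e \<in> complete_edges V. c e \<le> g}"
  show "(a, b) \<in> conn {e \<in> T. c e \<le> g}"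
  proof (rule ccontr)
    assume nc: "(a, b) \<notin> conn {e \<in> T. c e \<le> g}"
    have V: "a \<in> V" "b \<in> V" "a \<noteq> b" using ab by (auto simp: complete_edges_iff)
    have "(a, b) \<in> conn T" using assms(2) V by (auto simp: is_tree_def)
    then obtain f where f: "f \<in> T" "f \<notin> {e \<in> T. c e \<le> g}" "is_tree V (insert {a, b} (T - {f}))"
      using tree_exchange[OF assms(1,2) order_refl V _ nc] by metis
    have fin: "finite T" using is_tree_finite assms by blast
    have "{a, b} \<notin> T" using nc ab by (auto intro: conn_edge)
    then have "sum c (insert {a, b} (T - {f})) = c {a, b} + sum c T - c f"
      using fin f(1) by (simp add: sum_diff1)
    moreover have "c {a, b} < c f" using f ab by auto
    ultimately show False using min[OF f(3)] by linarith
  qed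
qed

lemma tree_card_complete:
  assumes "finite V" "is_tree V T" "U \<subseteq> V" "U \<noteq> {}"
  shows "card (T \<inter> complete_edges U) + 1 \<le> card U"
proof -
  have "ncomp V (T \<inter> complete_edges U) + card (T \<inter> complete_edges U) = card V"
    using assms by (intro tree_ncomp) auto
  moreover have "ncomp V (complete_edges U) \<le> ncomp V (T \<inter> complete_edges U)"
    using assms by (intro ncomp_antimono) auto
  moreover have "ncomp V {} + 1 \<le> ncomp V ({} \<union> complete_edges U) + card (comp_of {} ` U)"
    using assms by (intro ncomp_Un_complete_ge) auto
  moreover have "card (comp_of {} ` U) = card U" using ncomp_empty[of U] by (simp add: ncomp_def)
  ultimately show ?thesis by (simp add: ncomp_empty)
qed

text \<open>Deleting the closing edge of a cycle leaves its ends joined by the rest, so the number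
  of components stays the same, whereas by \<open>tree_ncomp\<close> it grows with every deleted
  edge.\<close>

lemma is_tree_imp_spanning_tree:
  assumes "finite V" "is_tree V T"
  shows "T \<in> spanning_trees V"
proof -
  have fT: "finite T" using is_tree_finite assms by blast
  have "False" if cyc: "graph_cycle T vs" for vs
  proof -
    let ?n = "length vs"
    have n: "?n \<ge> 3" and dist: "distinct vs"
      and E: "\<And>i. i < ?n \<Longrightarrow> {vs ! i, vs ! (Suc i mod ?n)} \<in> T"
      using cyc by (auto simp: graph_cycle_def)
    let ?f = "{vs ! (?n - 1), vs ! 0}"
    let ?T = "T - {?f}"
    have "Suc (?n - 1) = ?n" using n by simp
    then have "Suc (?n - 1) mod ?n = 0" by simp
    then have f: "?f \<in> T" using E[of "?n - 1"] n by fastforce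
    have step: "{vs ! i, vs ! Suc i} \<in> ?T" if "Suc i < ?n" for i
    proof -
      have "{vs ! i, vs ! Suc i} \<in> T" using E[of i] that by simp
      moreover have "{vs ! i, vs ! Suc i} \<noteq> ?f"
      proof -
        have "vs ! i \<noteq> vs ! (?n - 1)" using that dist by (subst nth_eq_iff_index_eq) auto
        \<comment> \<open>A cycle must have at least three vertices here: with two, the closing edge
          would also be the path edge.\<close>
        moreover have "i \<noteq> 0 \<or> Suc i \<noteq> ?n - 1" using n by auto
        then have "vs ! i \<noteq> vs ! 0 \<or> vs ! Suc i \<noteq> vs ! (?n - 1)"
          using that dist n nth_eq_iff_index_eq[of vs i 0] nth_eq_iff_index_eq[of vs "Suc i" "?n - 1"]
          by linarith
        ultimately show ?thesis by (auto simp: doubleton_eq_iff)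
      qed
      ultimately show ?thesis by simp
    qed
    have path: "i < ?n \<Longrightarrow> (vs ! 0, vs ! i) \<in> conn ?T" for i
    proof (induction i)
      case (Suc i)
      then show ?case using step[of i] by (meson Suc_lessD conn_edge conn_trans)
    qed simp
    have "(vs ! 0, vs ! (?n - 1)) \<in> conn ?T" using path[of "?n - 1"] n by linarith
    then have "ncomp V (insert ?f ?T) = ncomp V ?T" by (metis conn_sym ncomp_insert_conn)
    moreover have "insert ?f ?T = T" using f by auto
    moreover have "ncomp V T + card T = card V" "ncomp V ?T + card ?T = card V"
      using tree_ncomp[OF assms, of T] tree_ncomp[OF assms, of ?T] by auto
    moreover have "card ?T < card T" using f fT by (intro card_Diff1_less)
    ultimately show False by simp
  qed
  then show ?thesis using assms by (auto simp: spanning_trees_def is_tree_def graph_connected_def conn_def)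
qed

section \<open>Chains of cuts\<close>

text \<open>If \<open>G\<close> joined two vertices that \<open>F\<close> does not, adding this pair
  to \<open>F\<close> would lower its count by one without going below that of
  \<open>G\<close>.\<close>

lemma conn_if_ncomp_le:
  assumes "finite V" "F \<subseteq> G" "ncomp V F \<le> ncomp V G" "u \<in> V" "v \<in> V" "(u, v) \<in> conn G"
  shows "(u, v) \<in> conn F"
proof (rule ccontr)
  assume "(u, v) \<notin> conn F"
  then have "ncomp V F = ncomp V (insert {u, v} F) + 1"
    using assms by (intro ncomp_insert_not_conn)
  moreover have "ncomp V G \<le> ncomp V (insert {u, v} F)"
  proof (rule ncomp_antimono_conn[OF assms(1)])
    fix a b assume "(a, b) \<in> conn (insert {u, v} F)"
    then show "(a, b) \<in> conn G"
      using conn_insert[of a b u v F] conn_mono[OF assms(2)] assms(6)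
      by (meson conn_sym conn_trans)
  qed
  ultimately show False using assms(3) by linarith
qed

lemma card_pair_Int: "a \<noteq> b \<Longrightarrow> card ({a, b} \<inter> X) = Suc 0 \<longleftrightarrow> (a \<in> X) \<noteq> (b \<in> X)"
  by (cases "a \<in> X"; cases "b \<in> X") simp_all

locale cut_chain =
  fixes V :: "'a set" and L :: "'a set set"
  assumes finite_V: "finite V" and V_nonempty: "V \<noteq> {}"
    and proper: "X \<in> L \<Longrightarrow> X \<noteq> {} \<and> X \<subset> V"
    and chain: "X \<in> L \<Longrightarrow> Y \<in> L \<Longrightarrow> X \<subseteq> Y \<or> Y \<subseteq> X"
begin

text \<open>The chain divides \<open>V\<close> into linearly ordered levels, and the size of
  \<open>sep u v\<close> serves as the distance between the levels of \<open>u\<close> and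
  \<open>v\<close>.\<close>

definition sep :: "'a \<Rightarrow> 'a \<Rightarrow> 'a set set" where
  "sep u v = {X \<in> L. (u \<in> X) \<noteq> (v \<in> X)}"

definition crossed :: "'a set \<Rightarrow> 'a set set" where
  "crossed e = {X \<in> L. card (e \<inter> X) = 1}"

definition level_edges :: "'a set set \<Rightarrow> 'a set set" where
  "level_edges A = {e \<in> A. crossed e = {}}"

definition singly_crossed :: "'a set set \<Rightarrow> 'a set set" where
  "singly_crossed A = {X \<in> L. \<exists>e\<in>A. crossed e = {X}}"

lemma finite_L: "finite L"
  by (rule finite_subset[of _ "Pow V"]) (use proper finite_V in auto)

lemma crossed_pair: "u \<noteq> v \<Longrightarrow> crossed {u, v} = sep u v"
  by (simp add: crossed_def sep_def card_pair_Int)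

lemma sep_sym: "sep u v = sep v u"
  by (auto simp: sep_def)

lemma sep_self [simp]: "sep u u = {}"
  by (auto simp: sep_def)

lemma sep_triangle: "sep u w \<subseteq> sep u v \<union> sep v w"
  by (auto simp: sep_def)

lemma sep_subset_L: "sep u v \<subseteq> L"
  by (auto simp: sep_def)

lemma finite_sep: "finite (sep u v)"
  using finite_subset[OF sep_subset_L finite_L] .

lemma finite_edges: "A \<subseteq> complete_edges V \<Longrightarrow> finite A"
  using finite_complete_edges[OF finite_V] finite_subset by blast

lemma finite_singly_crossed: "finite (singly_crossed B)"
  using finite_L by (auto simp: singly_crossed_def)

lemma level_edges_Diff: "\<forall>e\<in>D. crossed e \<noteq> {} \<Longrightarrow> level_edges (A - D) = level_edges A"
  by (auto simp: level_edges_def)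

lemma level_edges_subset: "level_edges A \<subseteq> A"
  by (auto simp: level_edges_def)

text \<open>Any other set of the chain contains \<open>X\<close> or is contained in it; accordingly
  it contains, or misses, all four vertices, because it separates neither pair. So \<open>X\<close>
  determines the levels adjacent to it.\<close>

lemma sep_same_side:
  assumes "sep a b = {X}" "sep u v = {X}" "(a \<in> X) = (u \<in> X)"
  shows "sep a u = {}"
proof -
  have "(a \<in> Y) = (u \<in> Y)" if Y: "Y \<in> L" for Y
  proof (cases "Y = X")
    case False
    have "X \<in> sep a b" "X \<in> sep u v" using assms(1,2) by auto
    then have X: "X \<in> L" "(a \<in> X) \<noteq> (b \<in> X)" "(u \<in> X) \<noteq> (v \<in> X)" by (simp_all add: sep_def)
    have "Y \<notin> sep a b" "Y \<notin> sep u v" using assms(1,2) False by auto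
    then have "(a \<in> Y) = (b \<in> Y)" "(u \<in> Y) = (v \<in> Y)" using Y by (simp_all add: sep_def)
    then show ?thesis using chain[OF X(1) Y] X assms(3) by blast
  qed (use assms in simp)
  then show ?thesis by (auto simp: sep_def)
qed

lemma conn_level_sep:
  assumes "A \<subseteq> complete_edges V" "(u, v) \<in> conn (level_edges A)"
  shows "sep u v = {}"
  using assms(2)
proof (rule conn_invariant)
  fix a b assume ab: "{a, b} \<in> level_edges A" and a: "sep u a = {}"
  then have "{a, b} \<in> complete_edges V" using assms(1) level_edges_subset by blast
  then have "sep a b = {}" using ab crossed_pair[of a b] by (auto simp: level_edges_def complete_edges_iff)
  then show "sep u b = {}" using a sep_triangle[of u b a] by simp
qed simp

lemma crosses_pair_sep:
  assumes "{a, b} \<in> complete_edges V" "card ({a, b} \<inter> X) \<noteq> 1"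
  shows "a \<in> X \<longleftrightarrow> b \<in> X"
  using assms by (auto simp: complete_edges_iff card_pair_Int)

lemma conn_no_cross:
  assumes "A \<subseteq> complete_edges V" "(u, v) \<in> conn (A - {e. card (e \<inter> X) = 1})"
  shows "u \<in> X \<longleftrightarrow> v \<in> X"
  using assms(2)
proof (rule conn_invariant)
  fix a b assume ab: "{a, b} \<in> A - {e. card (e \<inter> X) = 1}" and a: "(u \<in> X) = (a \<in> X)"
  then have "{a, b} \<in> complete_edges V" "card ({a, b} \<inter> X) \<noteq> 1" using assms(1) by auto
  then show "(u \<in> X) = (b \<in> X)" using a crosses_pair_sep by blast
qed simp

end

section \<open>Points of the spanning tree polytope and their deficits\<close>

lemma sum_cut_split:
  fixes x :: "'a set \<Rightarrow> real"
  assumes "finite V" "X \<subseteq> V"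
  shows "sum x (complete_edges V) =
    sum x (complete_edges X) + sum x (complete_edges (V - X)) + sum x (cut V X)"
proof -
  have "complete_edges V = complete_edges X \<union> complete_edges (V - X) \<union> cut V X"
  proof (intro equalityI subsetI)
    fix e assume e: "e \<in> complete_edges V"
    then obtain a b where "e = {a, b}" "a \<in> V" "b \<in> V" "a \<noteq> b" by (rule complete_edgesE)
    with e show "e \<in> complete_edges X \<union> complete_edges (V - X) \<union> cut V X"
      by (auto simp: cut_def complete_edges_iff card_pair_Int)
  qed (use assms in \<open>auto simp: cut_def complete_edges_def\<close>)
  moreover have "complete_edges X \<inter> complete_edges (V - X) = {}"
    by (auto simp: complete_edges_def card_2_iff)
  moreover have "(complete_edges X \<union> complete_edges (V - X)) \<inter> cut V X = {}"
  proof -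
    have "card (e \<inter> X) \<noteq> 1" if "e \<in> complete_edges X" for e
      using that by (auto simp: complete_edges_def Int_absorb2)
    moreover have "card (e \<inter> X) \<noteq> 1" if "e \<in> complete_edges (V - X)" for e
    proof -
      have "e \<inter> X = {}" using that by (auto simp: complete_edges_def)
      then show ?thesis by simp
    qed
    ultimately show ?thesis by (auto simp: cut_def)
  qed
  moreover have "finite (complete_edges X)" "finite (complete_edges (V - X))" "finite (cut V X)"
    using assms finite_complete_edges[of X] finite_complete_edges[of "V - X"] finite_complete_edges[of V]
    by (auto simp: cut_def finite_subset)
  ultimately show ?thesis by (simp add: sum.union_disjoint)
qed

text \<open>The inequalities of the spanning tree polytope say that the deficit of a nonempty set is
  at least 1, with equality for \<open>V\<close>.\<close>

definition deficit :: "('a set \<Rightarrow> real) \<Rightarrow> 'a set \<Rightarrow> real" where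
  "deficit x U = real (card U) - sum x (complete_edges U)"

text \<open>These conditions are what the recursion preserves: membership in the spanning tree
  polytope, and equal deficits on both sides of each cut of the chain. The degree equations of the
  linear program need not survive when trees are split off.\<close>

locale balanced_point = cut_chain +
  fixes x :: "'a set \<Rightarrow> real"
  assumes x_nonneg: "e \<in> complete_edges V \<Longrightarrow> 0 \<le> x e"
    and deficit_V: "deficit x V = 1"
    and deficit_ge: "U \<subseteq> V \<Longrightarrow> U \<noteq> {} \<Longrightarrow> deficit x U \<ge> 1"
    and balanced: "X \<in> L \<Longrightarrow> deficit x X = deficit x (V - X)"
begin

lemma sum_x_mono: "A \<subseteq> B \<Longrightarrow> B \<subseteq> complete_edges V \<Longrightarrow> sum x A \<le> sum x B"
  using finite_edges x_nonneg by (intro sum_mono2) auto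

lemma sum_x_nonneg: "A \<subseteq> complete_edges V \<Longrightarrow> 0 \<le> sum x A"
  using x_nonneg by (intro sum_nonneg) auto

lemma sum_cut:
  assumes "X \<subseteq> V"
  shows "sum x (cut V X) = deficit x X + deficit x (V - X) - 1"
proof -
  have "card V = card X + card (V - X)"
    using assms finite_V by (metis card_Diff_subset card_mono finite_subset le_add_diff_inverse)
  then show ?thesis
    using sum_cut_split[OF finite_V assms, of x] deficit_V by (simp add: deficit_def)
qed

text \<open>The components of \<open>F\<close> that meet \<open>R\<close> partition it, as
  \<open>closed\<close> keeps them inside, and each component \<open>K\<close> contributes at most
  \<open>card K - 1\<close>.\<close>

lemma inside_sum_le:
  assumes F: "F \<subseteq> complete_edges V" and R: "R \<subseteq> V"
    and closed: "\<And>v w. v \<in> R \<Longrightarrow> (v, w) \<in> conn F \<Longrightarrow> w \<in> R"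
  shows "sum x (F \<inter> complete_edges R) \<le> real (card R) - real (card (comp_of F ` R))"
proof -
  let ?K = "comp_of F ` R"
  have fR: "finite R" using R finite_V finite_subset by blast
  have KR: "K \<subseteq> R" if "K \<in> ?K" for K using that closed by (auto simp: in_comp_of)
  have Kne: "K \<noteq> {}" if "K \<in> ?K" for K using that comp_of_self by (metis empty_iff imageE)
  have disj: "K \<inter> K' = {}" if K: "K \<in> ?K" "K' \<in> ?K" "K \<noteq> K'" for K K'
  proof (rule ccontr)
    assume "K \<inter> K' \<noteq> {}"
    then obtain w where "w \<in> K" "w \<in> K'" by auto
    moreover obtain v v' where "K = comp_of F v" "K' = comp_of F v'" using K by auto
    ultimately have "K = comp_of F w" "K' = comp_of F w"
      by (simp_all add: in_comp_of comp_of_eq_iff)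
    then show False using K(3) by simp
  qed
  have sub: "F \<inter> complete_edges R \<subseteq> (\<Union>K\<in>?K. complete_edges K)"
  proof
    fix e assume e: "e \<in> F \<inter> complete_edges R"
    then obtain a b where ab: "e = {a, b}" "a \<in> R" "b \<in> R" "a \<noteq> b" by (auto elim: complete_edgesE)
    then have "(a, b) \<in> conn F" using e by (auto intro: conn_edge)
    then have "e \<in> complete_edges (comp_of F a)" using ab by (simp add: complete_edges_iff in_comp_of)
    then show "e \<in> (\<Union>K\<in>?K. complete_edges K)" using ab by auto
  qed
  have "(\<Union>K\<in>?K. complete_edges K) \<subseteq> complete_edges V"
    using KR R complete_edges_mono by (metis (no_types, lifting) UN_least subset_trans)
  then have "sum x (F \<inter> complete_edges R) \<le> sum x (\<Union>K\<in>?K. complete_edges K)"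
    using sub by (rule sum_x_mono[rotated])
  also have "\<dots> = (\<Sum>K\<in>?K. sum x (complete_edges K))"
  proof (rule sum.UNION_disjoint)
    show "\<forall>K\<in>?K. finite (complete_edges K)"
      using KR fR finite_complete_edges finite_subset by metis
    show "\<forall>K\<in>?K. \<forall>K'\<in>?K. K \<noteq> K' \<longrightarrow> complete_edges K \<inter> complete_edges K' = {}"
    proof (intro ballI impI)
      fix K K' assume "K \<in> ?K" "K' \<in> ?K" "K \<noteq> K'"
      then have "K \<inter> K' = {}" by (rule disj)
      then show "complete_edges K \<inter> complete_edges K' = {}"
        by (auto simp: complete_edges_def card_2_iff)
    qed
  qed (use fR in auto)
  also have "\<dots> \<le> (\<Sum>K\<in>?K. real (card K) - 1)"
  proof (rule sum_mono)
    fix K assume "K \<in> ?K"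
    then have "deficit x K \<ge> 1" using KR Kne R deficit_ge by (metis subset_trans)
    then show "sum x (complete_edges K) \<le> real (card K) - 1" by (simp add: deficit_def)
  qed
  also have "\<dots> = real (\<Sum>K\<in>?K. card K) - real (card ?K)"
    by (simp add: sum_subtractf)
  also have "(\<Sum>K\<in>?K. card K) = card (\<Union>?K)"
  proof (rule card_Union_disjoint[symmetric])
    show "pairwise disjnt ?K" using disj by (auto simp: pairwise_def disjnt_def)
    show "finite K" if "K \<in> ?K" for K using KR[OF that] fR by (rule finite_subset)
  qed
  also have "\<Union>?K = R"
  proof
    show "\<Union>?K \<subseteq> R" using KR by auto
    show "R \<subseteq> \<Union>?K" using comp_of_self by auto
  qed
  finally show ?thesis .
qed

lemma sum_le_rank:
  assumes "A \<subseteq> complete_edges V"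
  shows "sum x A \<le> real (card V) - real (ncomp V A)"
  using inside_sum_le[OF assms order_refl] conn_in_V[OF assms] assms
  by (simp add: ncomp_def Int_absorb2)

text \<open>Inclusion-exclusion for the edges inside \<open>Y\<close> and those inside
  \<open>V - X\<close>: together they miss just the edges crossing both cuts, and they share those
  inside \<open>Y - X\<close>. Balance turns the deficit of \<open>V - X\<close> into that of
  \<open>X\<close>.\<close>

lemma sum_two_cuts:
  assumes "X \<in> L" "Y \<in> L" "X \<subset> Y"
  shows "sum x {e \<in> complete_edges V. card (e \<inter> X) = 1 \<and> card (e \<inter> Y) = 1}
    + deficit x (Y - X) = deficit x X + deficit x Y - 1"
proof -
  let ?B = "{e \<in> complete_edges V. card (e \<inter> X) = 1 \<and> card (e \<inter> Y) = 1}"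
  let ?Y = "complete_edges Y" and ?X = "complete_edges (V - X)"
  have XYV: "X \<subseteq> V" "Y \<subseteq> V" using proper assms by auto
  have fin: "finite ?Y" "finite ?X" using finite_V XYV by (auto intro!: finite_complete_edges finite_subset[of Y V])
  have U: "?Y \<union> ?X = complete_edges V - ?B"
  proof (intro equalityI subsetI)
    fix e assume e: "e \<in> ?Y \<union> ?X"
    show "e \<in> complete_edges V - ?B"
    proof (cases "e \<in> ?Y")
      case True
      then have "e \<inter> Y = e" "card e = 2" "e \<subseteq> V" using XYV by (auto simp: complete_edges_def)
      then show ?thesis by (simp add: complete_edges_def)
    next
      case False
      then have "e \<inter> X = {}" "card e = 2" "e \<subseteq> V" using e by (auto simp: complete_edges_def)
      then show ?thesis by (simp add: complete_edges_def)
    qed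
  next
    fix e assume e: "e \<in> complete_edges V - ?B"
    then have "e \<in> complete_edges V" by simp
    then obtain a b where "e = {a, b}" "a \<in> V" "b \<in> V" "a \<noteq> b" by (rule complete_edgesE)
    then show "e \<in> ?Y \<union> ?X"
      using e assms(3) by (auto simp: complete_edges_iff card_pair_Int)
  qed
  have I: "?Y \<inter> ?X = complete_edges (Y - X)"
    using XYV by (auto simp: complete_edges_def)
  have "sum x ?Y + sum x ?X = sum x (complete_edges V - ?B) + sum x (complete_edges (Y - X))"
    using sum.union_inter[OF fin, of x] U I by simp
  moreover have "sum x (complete_edges V - ?B) = sum x (complete_edges V) - sum x ?B"
    using finite_edges by (intro sum_diff) auto
  moreover have "card (Y - X) + card X = card Y" "card (V - X) + card X = card V"
    using assms XYV finite_V finite_subset[of X V]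
    by (auto simp: card_Diff_subset card_mono finite_subset[of Y V])
  moreover have "deficit x X = deficit x (V - X)" using balanced assms by simp
  ultimately show ?thesis using deficit_V by (simp add: deficit_def)
qed

end

section \<open>The rank inequality\<close>

locale slack_point = balanced_point +
  fixes lam :: real
  assumes lam: "0 \<le> lam" "lam \<le> 1"
    and cut_le: "X \<in> L \<Longrightarrow> sum x (cut V X) \<le> 2 - lam"
begin

text \<open>By balance the cut has weight \<open>2 * deficit x X - 1\<close>.\<close>

lemma deficit_L: "X \<in> L \<Longrightarrow> deficit x X \<le> (3 - lam) / 2"
  using cut_le[of X] sum_cut[of X] balanced[of X] proper[of X] by auto

text \<open>In \<open>sum_two_cuts\<close> the right-hand side is at most
  \<open>(3 - lam) - 1\<close>, and \<open>deficit x (Y - X)\<close> takes away at least 1.\<close>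

lemma two_cuts_le:
  assumes "X \<in> L" "Y \<in> L" "X \<subset> Y"
  shows "sum x {e \<in> complete_edges V. card (e \<inter> X) = 1 \<and> card (e \<inter> Y) = 1} \<le> 1 - lam"
proof -
  have "deficit x (Y - X) \<ge> 1" using deficit_ge[of "Y - X"] proper assms by blast
  then show ?thesis using sum_two_cuts[OF assms] deficit_L[of X] deficit_L[of Y] assms by simp
qed

text \<open>The region is bounded by the nearest sets outside \<open>Q\<close> on either side of
  \<open>u\<close>, so it is a difference of two sets of the chain, where \<open>V\<close> and the
  empty set stand in for missing ones. If both bounds exist, \<open>sum_two_cuts\<close> with the
  doubly crossing edges dropped gives \<open>(3 - lam) - 1\<close>.\<close>

lemma deficit_region:
  assumes "u \<in> V"
  shows "deficit x {z \<in> V. sep u z \<subseteq> Q} \<le> 2 - lam"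
proof -
  let ?R = "{z \<in> V. sep u z \<subseteq> Q}"
  define lo where "lo = {X \<in> L - Q. u \<notin> X}"
  define hi where "hi = {X \<in> L - Q. u \<in> X}"
  have R: "?R = (V - \<Union>lo) \<inter> (\<Inter>hi)"
    using assms by (auto simp: lo_def hi_def sep_def)
  have fin: "finite lo" "finite hi" using finite_L by (auto simp: lo_def hi_def)
  have ch: "subset.chain L lo" "subset.chain L hi"
    unfolding subset_chain_def using chain by (auto simp: lo_def hi_def)
  have lo: "\<Union>lo \<in> lo" if "lo \<noteq> {}" using Union_in_chain[OF fin(1) that ch(1)] .
  have hi: "\<Inter>hi \<in> hi" if "hi \<noteq> {}" using Inter_in_chain[OF fin(2) that ch(2)] .
  have le: "(3 - lam) / 2 \<le> 2 - lam" using lam by simp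
  show ?thesis
  proof (cases "lo = {}"; cases "hi = {}")
    assume "lo = {}" "hi = {}"
    then have "?R = V" using R by auto
    then show ?thesis using deficit_V lam by simp
  next
    assume *: "lo = {}" "hi \<noteq> {}"
    then have "\<Inter>hi \<in> L" using hi by (auto simp: hi_def)
    moreover from this have "?R = \<Inter>hi" using R * proper by auto
    ultimately show ?thesis using deficit_L le by fastforce
  next
    assume *: "lo \<noteq> {}" "hi = {}"
    then have "\<Union>lo \<in> L" using lo by (auto simp: lo_def)
    moreover have "?R = V - \<Union>lo" using R * by auto
    ultimately show ?thesis using deficit_L le balanced by fastforce
  next
    assume *: "lo \<noteq> {}" "hi \<noteq> {}"
    let ?X = "\<Union>lo" and ?Y = "\<Inter>hi"
    have X: "?X \<in> L" "u \<notin> ?X" using lo[OF *(1)] by (auto simp: lo_def)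
    have Y: "?Y \<in> L" "u \<in> ?Y" using hi[OF *(2)] by (auto simp: hi_def)
    have "?X \<subset> ?Y" using chain[OF X(1) Y(1)] X Y by auto
    moreover have "?R = ?Y - ?X" using R proper[OF Y(1)] by auto
    moreover have "0 \<le> sum x {e \<in> complete_edges V. card (e \<inter> ?X) = 1 \<and> card (e \<inter> ?Y) = 1}"
      by (rule sum_x_nonneg) auto
    ultimately show ?thesis
      using sum_two_cuts[OF X(1) Y(1)] deficit_L[OF X(1)] deficit_L[OF Y(1)] by simp
  qed
qed

text \<open>The first bracket is the rank in the matroid of trees crossing every cut of the chain once:
  its bases consist of a spanning tree of each level and one edge between any two consecutive ones.\<close>
definition mixed_rank :: "'a set set \<Rightarrow> real" where
  "mixed_rank A = lam * (real (card V) - real (ncomp V (level_edges A)) + real (card (singly_crossed A)))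
    + (1 - lam) * (real (card V) - real (ncomp V A))"

text \<open>For \<open>Q = {}\<close> the set \<open>R\<close> is the level of \<open>u\<close>, for
  \<open>Q = {X}\<close> it is the union of the two levels adjacent to \<open>X\<close>. If
  \<open>R\<close> meets \<open>q\<close> components of the level edges, filling it raises the
  weight by at least \<open>q - 2 + lam\<close>, the first rank by at most \<open>q - 1\<close>, and
  the second by at most \<open>q - 2\<close>, as \<open>A\<close> already merges two of these
  components.\<close>

lemma fill_region:
  assumes A: "A \<subseteq> complete_edges V" and uv: "u \<in> V" "v \<in> V" "(u, v) \<in> conn A"
    and Q: "sep u v = Q" "Q = {} \<and> (u, v) \<notin> conn (level_edges A) \<or> (\<exists>X. Q = {X} \<and> X \<notin> singly_crossed A)"
  obtains A' where "A \<subset> A'" "A' \<subseteq> complete_edges V"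
    "sum x A - mixed_rank A \<le> sum x A' - mixed_rank A'"
proof -
  define R where "R = {z \<in> V. sep u z \<subseteq> Q}"
  let ?A0 = "level_edges A" and ?ER = "complete_edges R"
  let ?A' = "A \<union> ?ER"
  define q where "q = card (comp_of ?A0 ` R)"
  have RV: "R \<subseteq> V" by (auto simp: R_def)
  have uR: "u \<in> R" and vR: "v \<in> R" using uv Q by (auto simp: R_def)
  have fR: "finite R" using RV finite_V finite_subset by blast
  have nc0: "(u, v) \<notin> conn ?A0" using Q conn_level_sep[OF A, of u v] by auto
  then have uv_ne: "u \<noteq> v" by auto
  have uvER: "{u, v} \<in> ?ER" using uR vR uv_ne by (simp add: complete_edges_iff)
  have A0E: "?A0 \<subseteq> complete_edges V" using A level_edges_subset by blast
  have crR: "crossed e \<subseteq> Q" if e: "e \<in> ?ER" for e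
  proof -
    obtain a b where ab: "e = {a, b}" "a \<in> R" "b \<in> R" "a \<noteq> b" using e by (rule complete_edgesE)
    then have "sep u a \<subseteq> Q" "sep u b \<subseteq> Q" by (auto simp: R_def)
    moreover have "sep a b \<subseteq> sep u a \<union> sep u b" using sep_triangle[of a b u] sep_sym by metis
    ultimately show ?thesis using ab crossed_pair by auto
  qed
  \<comment> \<open>An edge of \<open>A\<close> inside \<open>R\<close> that is not level would
    cross \<open>X\<close> and nothing else, which would make \<open>X\<close> singly
    crossed.\<close>
  have inner: "A \<inter> ?ER \<subseteq> ?A0 \<inter> ?ER"
  proof
    fix e assume e: "e \<in> A \<inter> ?ER"
    have "crossed e = {}"
    proof (rule ccontr)
      assume ne: "crossed e \<noteq> {}"
      then obtain X where X: "Q = {X}" "X \<notin> singly_crossed A" using Q crR[of e] e by auto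
      then have "crossed e = {X}" using ne crR[of e] e by auto
      moreover have "X \<in> L" using X Q sep_subset_L[of u v] by auto
      ultimately show False using X e by (auto simp: singly_crossed_def)
    qed
    then show "e \<in> ?A0 \<inter> ?ER" using e by (simp add: level_edges_def)
  qed
  have closed: "w \<in> R" if "z \<in> R" "(z, w) \<in> conn ?A0" for z w
  proof -
    have "sep z w = {}" using conn_level_sep[OF A] that by simp
    then have "sep u w \<subseteq> Q" using sep_triangle[of u w z] that by (auto simp: R_def)
    moreover have "w \<in> V" using conn_in_V[OF A0E that(2)] that RV by auto
    ultimately show ?thesis by (simp add: R_def)
  qed
  have "sum x (A \<inter> ?ER) \<le> sum x (?A0 \<inter> ?ER)" using inner A0E by (intro sum_x_mono) auto
  also have "\<dots> \<le> real (card R) - real q"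
    unfolding q_def by (rule inside_sum_le[OF A0E RV]) (rule closed)
  finally have xin: "sum x (A \<inter> ?ER) \<le> real (card R) - real q" .
  have ERE: "?ER \<subseteq> complete_edges V" using RV by (rule complete_edges_mono)
  have "sum x (A \<union> ?ER) + sum x (A \<inter> ?ER) = sum x A + sum x ?ER"
    using finite_edges A ERE by (intro sum.union_inter) auto
  moreover have "sum x ?ER \<ge> real (card R) - 2 + lam"
    using deficit_region[OF uv(1), of Q] unfolding R_def[symmetric] by (simp add: deficit_def)
  ultimately have gain: "sum x ?A' \<ge> sum x A + real q - 2 + lam" using xin by linarith
  \<comment> \<open>Each component of the level edges lies in one component of \<open>A\<close>, and
    this assignment is not injective on \<open>R\<close> because \<open>A\<close> joins
    \<open>u\<close> to \<open>v\<close>.\<close>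
  have "card (comp_of A ` R) < q"
  proof -
    have eq: "(\<Union>k\<in>comp_of ?A0 z. comp_of A k) = comp_of A z" for z
    proof -
      have "comp_of A k = comp_of A z" if "k \<in> comp_of ?A0 z" for k
        using that conn_mono[OF level_edges_subset] by (metis comp_of_eq_iff in_comp_of)
      then show ?thesis using comp_of_self[of z ?A0] by blast
    qed
    then have "comp_of A ` R = (\<lambda>K. \<Union>k\<in>K. comp_of A k) ` (comp_of ?A0 ` R)"
      by (simp add: image_image)
    moreover have "\<not> inj_on (\<lambda>K. \<Union>k\<in>K. comp_of A k) (comp_of ?A0 ` R)"
    proof
      assume inj: "inj_on (\<lambda>K. \<Union>k\<in>K. comp_of A k) (comp_of ?A0 ` R)"
      have "comp_of A u = comp_of A v" using uv by (simp add: comp_of_eq_iff)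
      then have "comp_of ?A0 u = comp_of ?A0 v"
        using inj_onD[OF inj, of "comp_of ?A0 u" "comp_of ?A0 v"] uR vR eq by simp
      then show False using nc0 by (simp add: comp_of_eq_iff)
    qed
    ultimately show ?thesis unfolding q_def using fR
      by (metis card_image_le eq_card_imp_inj_on finite_imageI le_neq_implies_less)
  qed
  moreover have "ncomp V A + 1 \<le> ncomp V ?A' + card (comp_of A ` R)"
    using ncomp_Un_complete_ge[OF finite_V RV, of A] uR by auto
  ultimately have c': "ncomp V A + 2 \<le> ncomp V ?A' + q" by linarith
  have N: "ncomp V ?A0 + 1 \<le> ncomp V (?A0 \<union> ?ER) + q"
    unfolding q_def using ncomp_Un_complete_ge[OF finite_V RV, of ?A0] uR by auto
  have lev': "level_edges ?A' \<subseteq> ?A0 \<union> ?ER" by (auto simp: level_edges_def)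
  note fsc = finite_singly_crossed
  have r: "ncomp V ?A0 + card (singly_crossed ?A') + 1 \<le> ncomp V (level_edges ?A') + card (singly_crossed A) + q"
  proof (cases "Q = {}")
    case True
    have "singly_crossed ?A' = singly_crossed A"
      using crR True by (auto simp: singly_crossed_def)
    moreover have "ncomp V (?A0 \<union> ?ER) \<le> ncomp V (level_edges ?A')"
      using lev' finite_V by (intro ncomp_antimono)
    ultimately show ?thesis using N by simp
  next
    case False
    then obtain X where X: "Q = {X}" using Q by auto
    have "singly_crossed ?A' \<subseteq> insert X (singly_crossed A)"
      using crR X by (fastforce simp: singly_crossed_def)
    then have "card (singly_crossed ?A') \<le> card (insert X (singly_crossed A))"
      using fsc by (intro card_mono) auto
    also have "\<dots> \<le> Suc (card (singly_crossed A))" using fsc by (simp add: card_insert_if)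
    finally have m: "card (singly_crossed ?A') \<le> Suc (card (singly_crossed A))" .
    \<comment> \<open>The possible gain of one from \<open>X\<close> is paid for here: level edges
      cannot join \<open>u\<close> to \<open>v\<close> across \<open>X\<close>, so they leave at
      least one more component than \<open>?A0 \<union> ?ER\<close> does.\<close>
    have "?A' \<subseteq> complete_edges V" using A ERE by simp
    from conn_level_sep[OF this, of u v] have "(u, v) \<notin> conn (level_edges ?A')"
      using Q X by auto
    then have "ncomp V (level_edges ?A') = ncomp V (insert {u, v} (level_edges ?A')) + 1"
      using finite_V uv by (intro ncomp_insert_not_conn)
    moreover have "ncomp V (?A0 \<union> ?ER) \<le> ncomp V (insert {u, v} (level_edges ?A'))"
      using lev' uvER finite_V by (intro ncomp_antimono) auto
    ultimately show ?thesis using N m by simp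
  qed
  have "mixed_rank ?A' - mixed_rank A \<le> lam * (real q - 1) + (1 - lam) * (real q - 2)"
  proof -
    have "mixed_rank ?A' - mixed_rank A =
      lam * (real (ncomp V ?A0) - real (ncomp V (level_edges ?A')) + real (card (singly_crossed ?A')) - real (card (singly_crossed A)))
      + (1 - lam) * (real (ncomp V A) - real (ncomp V ?A'))"
      by (simp add: mixed_rank_def algebra_simps)
    also have "\<dots> \<le> lam * (real q - 1) + (1 - lam) * (real q - 2)"
      using r c' lam by (intro add_mono mult_left_mono) auto
    finally show ?thesis .
  qed
  also have "\<dots> = real q - 2 + lam" by (simp add: algebra_simps)
  finally have "sum x A - mixed_rank A \<le> sum x ?A' - mixed_rank ?A'" using gain by linarith
  moreover have "{u, v} \<notin> A"
  proof
    assume "{u, v} \<in> A"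
    then have "{u, v} \<in> A \<inter> ?ER" using uvER by simp
    then have "{u, v} \<in> ?A0" using inner by auto
    then show False using nc0 conn_edge by metis
  qed
  then have "A \<subset> ?A'" using uvER by auto
  ultimately show ?thesis using that A ERE by auto
qed

section \<open>Deleting edges across the cuts\<close>

definition aligned :: "'a set set \<Rightarrow> bool" where
  "aligned A \<longleftrightarrow> (\<forall>u\<in>V. \<forall>v\<in>V. (u, v) \<in> conn A \<longrightarrow>
     (sep u v = {} \<longrightarrow> (u, v) \<in> conn (level_edges A)) \<and>
     (\<forall>X. sep u v = {X} \<longrightarrow> X \<in> singly_crossed A))"

text \<open>The level edges and one representative edge per singly crossed set connect all that
  \<open>A\<close> connects, and each representative saves at most one component. The induction runs
  over the number of sets separating two vertices.\<close>

lemma irreducible_level_ncomp: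
  assumes A: "A \<subseteq> complete_edges V" and al: "aligned A"
    and one: "\<And>X. X \<in> singly_crossed A \<Longrightarrow> ncomp V (A - {e. card (e \<inter> X) = 1}) \<le> ncomp V A + 1"
    and two: "\<And>X Y. X \<in> L \<Longrightarrow> Y \<in> L \<Longrightarrow> X \<subset> Y \<Longrightarrow>
      ncomp V (A - {e. card (e \<inter> X) = 1 \<and> card (e \<inter> Y) = 1}) \<le> ncomp V A"
  shows "ncomp V (level_edges A) \<le> ncomp V A + card (singly_crossed A)"
proof -
  have "\<forall>X\<in>singly_crossed A. \<exists>e\<in>A. crossed e = {X}" by (auto simp: singly_crossed_def)
  then obtain ed where ed: "\<And>X. X \<in> singly_crossed A \<Longrightarrow> ed X \<in> A \<and> crossed (ed X) = {X}"
    by metis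
  let ?D = "ed ` singly_crossed A"
  let ?B = "level_edges A \<union> ?D"
  have DA: "?D \<subseteq> A" using ed by auto
  note fsc = finite_singly_crossed
  have conn_B: "(u, v) \<in> conn ?B" if "u \<in> V" "v \<in> V" "(u, v) \<in> conn A" for u v
    using that
  proof (induction "card (sep u v)" arbitrary: u v rule: less_induct)
    case less
    note uv = less.prems
    have level: "(p, q) \<in> conn ?B" if "p \<in> V" "q \<in> V" "(p, q) \<in> conn A" "sep p q = {}" for p q
      using al that conn_mono[of "level_edges A" ?B] by (auto simp: aligned_def)
    consider (0) "sep u v = {}" | (1) X where "sep u v = {X}" |
      (2) X Y where "X \<in> sep u v" "Y \<in> sep u v" "X \<noteq> Y" by auto
    then show ?case
    proof cases
      case 0
      then show ?thesis using level uv by simp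
    next
      case (1 X)
      then have X: "X \<in> singly_crossed A" using al uv by (auto simp: aligned_def)
      have XL: "X \<in> L" "(u \<in> X) \<noteq> (v \<in> X)" using 1 by (auto simp: sep_def)
      have e: "ed X \<in> A" "crossed (ed X) = {X}" using ed X by auto
      then have "ed X \<in> complete_edges V" using A by blast
      then obtain a b where ab: "ed X = {a, b}" "a \<in> V" "b \<in> V" "a \<noteq> b" by (rule complete_edgesE)
      have sab: "sep a b = {X}" using e ab crossed_pair by simp
      have abA: "(a, b) \<in> conn A" using e ab by (auto intro: conn_edge)
      let ?A' = "A - {e. card (e \<inter> X) = 1}"
      \<comment> \<open>If the representative lay in another component than \<open>u\<close> and
        \<open>v\<close>, deleting the edges across \<open>X\<close> would split both components,
        against \<open>one\<close>.\<close>
      have "(a, u) \<in> conn A"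
      proof (rule ccontr)
        assume nau: "(a, u) \<notin> conn A"
        have n1: "(u, v) \<notin> conn ?A'" using conn_no_cross[OF A] XL by blast
        have n2: "(a, b) \<notin> conn (insert {u, v} ?A')"
        proof
          assume "(a, b) \<in> conn (insert {u, v} ?A')"
          then have "(a, b) \<in> conn ?A' \<or> (a, u) \<in> conn ?A' \<or> (a, v) \<in> conn ?A'"
            using conn_insert by metis
          moreover have "(a, b) \<notin> conn ?A'"
            using conn_no_cross[OF A, of a b X] sab by (auto simp: sep_def)
          moreover have "(a, v) \<notin> conn A" using nau uv(3) by (meson conn_sym conn_trans)
          ultimately show False using nau conn_mono[of ?A' A] by blast
        qed
        have "ncomp V ?A' = ncomp V (insert {a, b} (insert {u, v} ?A')) + 2"
          using ncomp_insert_not_conn[OF finite_V uv(1,2) n1]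
            ncomp_insert_not_conn[OF finite_V ab(2,3) n2] by simp
        moreover have "ncomp V A \<le> ncomp V (insert {a, b} (insert {u, v} ?A'))"
        proof (rule ncomp_antimono_conn[OF finite_V])
          fix p q assume "(p, q) \<in> conn (insert {a, b} (insert {u, v} ?A'))"
          then show "(p, q) \<in> conn A"
          proof (rule conn_subset[rotated])
            fix c d assume "{c, d} \<in> insert {a, b} (insert {u, v} ?A')"
            then consider "{c, d} = {a, b}" | "{c, d} = {u, v}" | "{c, d} \<in> A" by auto
            then show "(c, d) \<in> conn A"
              by cases (use abA uv(3) conn_sym conn_edge in \<open>metis doubleton_eq_iff\<close>)+
          qed
        qed
        ultimately show False using one[OF X] by linarith
      qed
      then have conns: "(a, u) \<in> conn A" "(b, u) \<in> conn A" "(a, v) \<in> conn A" "(b, v) \<in> conn A"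
        using abA uv(3) by (meson conn_sym conn_trans)+
      have "(a, b) \<in> conn ?B" using ab X by (intro conn_edge) auto
      moreover have "sep a u = {} \<and> sep b v = {} \<or> sep b u = {} \<and> sep a v = {}"
      proof -
        have "(a \<in> X) \<noteq> (b \<in> X)" using sab XL by (auto simp: sep_def)
        then consider "(a \<in> X) = (u \<in> X)" "(b \<in> X) = (v \<in> X)" | "(b \<in> X) = (u \<in> X)" "(a \<in> X) = (v \<in> X)"
          using XL by auto
        then show ?thesis
          using sep_same_side[OF sab 1] sep_same_side[OF _ 1, of b a]
            sep_same_side[OF sab, of v u] sep_same_side[of b a X v u] sab 1 sep_sym
          by cases metis+
      qed
      ultimately show ?thesis
        using level[of a u] level[of b v] level[of b u] level[of a v] ab uv conns
        by (meson conn_sym conn_trans)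
    next
      case (2 X' Y')
      then obtain X Y where XY: "X \<in> sep u v" "Y \<in> sep u v" "X \<subset> Y"
        using chain[of X' Y'] sep_subset_L[of u v] by blast
      then have XYL: "X \<in> L" "Y \<in> L" by (auto simp: sep_def)
      let ?A' = "A - {e. card (e \<inter> X) = 1 \<and> card (e \<inter> Y) = 1}"
      \<comment> \<open>No component splits when the edges across both \<open>X\<close> and
        \<open>Y\<close> are deleted, so a remaining path leaves \<open>X\<close> at a vertex
        \<open>z\<close> inside \<open>Y\<close>. This \<open>z\<close> is separated from either end
        by fewer sets.\<close>
      have main: "(p, q) \<in> conn ?B"
        if pq: "p \<in> V" "q \<in> V" "(p, q) \<in> conn A" "sep p q = sep u v" "p \<in> X" "q \<notin> Y" for p q
      proof -
        have "(p, q) \<in> conn ?A'"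
          using two[OF XYL XY(3)] pq by (intro conn_if_ncomp_le[OF finite_V, of ?A' A]) auto
        moreover have "q \<notin> X" using pq XY(3) by auto
        ultimately obtain a z where az: "{a, z} \<in> ?A'" "a \<in> X" "z \<notin> X"
          "(p, a) \<in> conn ?A'" "(z, q) \<in> conn ?A'"
          using conn_leaves[of p q ?A' "\<lambda>w. w \<in> X"] pq(5) by blast
        have azE: "{a, z} \<in> complete_edges V" using az A by auto
        then have zV: "z \<in> V" "a \<noteq> z" by (auto simp: complete_edges_iff)
        have zY: "z \<in> Y"
          using az XY(3) card_pair_Int[OF zV(2)] by auto
        have conns: "(p, z) \<in> conn A" "(z, q) \<in> conn A"
          using az conn_mono[of ?A' A] by (blast intro: conn_trans conn_edge)+
        have "sep p z \<subseteq> sep p q" "sep z q \<subseteq> sep p q"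
          using pq(5,6) az(3) zY XYL XY(3) chain unfolding sep_def by blast+
        moreover have "Y \<notin> sep p z" "X \<notin> sep z q"
          using pq(5,6) az(3) zY XY(3) by (auto simp: sep_def)
        ultimately have "sep p z \<subset> sep u v" "sep z q \<subset> sep u v"
          using XY pq(4) by auto
        then have "card (sep p z) < card (sep u v)" "card (sep z q) < card (sep u v)"
          using finite_sep psubset_card_mono by blast+
        then have "(p, z) \<in> conn ?B" "(z, q) \<in> conn ?B"
          using less.hyps pq zV conns by blast+
        then show ?thesis by (rule conn_trans)
      qed
      have "u \<in> X \<and> v \<notin> Y \<or> v \<in> X \<and> u \<notin> Y"
        using XY by (auto simp: sep_def)
      then show ?thesis
        using main[of u v] main[of v u] uv sep_sym conn_sym by metis
    qed
  qed
  have "ncomp V ?B \<le> ncomp V A"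
    using conn_B finite_V by (intro ncomp_antimono_conn)
  moreover have "ncomp V (level_edges A) \<le> ncomp V ?B + card ?D"
    using ncomp_Un_ge[OF finite_V, of ?D "level_edges A"] fsc DA A by auto
  moreover have "card ?D \<le> card (singly_crossed A)" using fsc by (rule card_image_le)
  ultimately show ?thesis by linarith
qed

text \<open>Deleting the edges across \<open>X\<close> costs weight at most \<open>2 - lam\<close>
  and mixed rank at least \<open>lam + (1 - lam) * 2\<close>, which is the same; for the edges
  across two cuts both bounds are \<open>1 - lam\<close>. If neither deletion applies,
  \<open>irreducible_level_ncomp\<close> makes the first rank at least the second, which bounds the
  weight.\<close>

lemma sum_le_mixed_rank_aligned:
  assumes "A \<subseteq> complete_edges V" "aligned A"
  shows "sum x A \<le> mixed_rank A"
  using assms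
proof (induction "card A" arbitrary: A rule: less_induct)
  case less
  note A = less.prems
  have fA: "finite A" using finite_edges A by blast
  consider (1) X where "X \<in> singly_crossed A" "ncomp V (A - {e. card (e \<inter> X) = 1}) \<ge> ncomp V A + 2" |
    (2) X Y where "X \<in> L" "Y \<in> L" "X \<subset> Y"
      "ncomp V (A - {e. card (e \<inter> X) = 1 \<and> card (e \<inter> Y) = 1}) > ncomp V A" |
    (3) "ncomp V (level_edges A) \<le> ncomp V A + card (singly_crossed A)"
  proof -
    note that
    moreover have "ncomp V (level_edges A) \<le> ncomp V A + card (singly_crossed A)"
      if neg: "\<not> (\<exists>X. X \<in> singly_crossed A \<and> ncomp V (A - {e. card (e \<inter> X) = 1}) \<ge> ncomp V A + 2)"
        "\<not> (\<exists>X Y. X \<in> L \<and> Y \<in> L \<and> X \<subset> Y \<and>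
          ncomp V (A - {e. card (e \<inter> X) = 1 \<and> card (e \<inter> Y) = 1}) > ncomp V A)"
    proof (rule irreducible_level_ncomp[OF A])
      show "ncomp V (A - {e. card (e \<inter> X) = 1}) \<le> ncomp V A + 1" if "X \<in> singly_crossed A" for X
      proof -
        have "\<not> ncomp V A + 2 \<le> ncomp V (A - {e. card (e \<inter> X) = 1})" using neg(1) that by blast
        then show ?thesis by linarith
      qed
      show "ncomp V (A - {e. card (e \<inter> X) = 1 \<and> card (e \<inter> Y) = 1}) \<le> ncomp V A"
        if "X \<in> L" "Y \<in> L" "X \<subset> Y" for X Y
        using neg(2) that by (meson not_le)
    qed
    ultimately show thesis by blast
  qed
  then show ?case
  proof cases
    case (1 X)
    let ?D = "{e. card (e \<inter> X) = 1}"
    let ?A' = "A - ?D"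
    have XL: "X \<in> L" using 1 by (simp add: singly_crossed_def)
    have lev: "level_edges ?A' = level_edges A"
      using XL by (intro level_edges_Diff) (auto simp: crossed_def)
    have sc: "singly_crossed ?A' = singly_crossed A - {X}"
      using XL by (auto simp: singly_crossed_def crossed_def)
    obtain e where e: "e \<in> A" "crossed e = {X}" using 1 by (auto simp: singly_crossed_def)
    then have "e \<in> ?D" by (auto simp: crossed_def)
    then have "?A' \<subset> A" using e by auto
    then have "card ?A' < card A" using fA by (rule psubset_card_mono[rotated])
    \<comment> \<open>Alignment survives: the level edges stay, and the only set dropped from
      \<open>singly_crossed\<close> is \<open>X\<close>, which no longer separates connected
      vertices.\<close>
    moreover have "aligned ?A'"
      unfolding aligned_def
    proof (intro ballI impI conjI allI)
      fix u v assume uv: "u \<in> V" "v \<in> V" "(u, v) \<in> conn ?A'"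
      then have uvA: "(u, v) \<in> conn A" using conn_mono[of ?A' A] by blast
      show "(u, v) \<in> conn (level_edges ?A')" if "sep u v = {}"
        using A(2) uv uvA that lev by (auto simp: aligned_def)
      fix Y assume Y: "sep u v = {Y}"
      then have "Y \<in> singly_crossed A" using A(2) uv uvA by (auto simp: aligned_def)
      moreover have "X \<notin> sep u v" using conn_no_cross[OF A(1) uv(3)] by (auto simp: sep_def)
      ultimately show "Y \<in> singly_crossed ?A'" using sc Y by auto
    qed
    ultimately have IH: "sum x ?A' \<le> mixed_rank ?A'" using less.hyps A by blast
    have "sum x A = sum x ?A' + sum x (A \<inter> ?D)"
      using sum.Int_Diff[OF fA, of x ?D] by simp
    moreover have "sum x (A \<inter> ?D) \<le> sum x (cut V X)"
      using A by (intro sum_x_mono) (auto simp: cut_def)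
    moreover have "mixed_rank A = mixed_rank ?A' + lam * 1 + (1 - lam) * (real (ncomp V ?A') - real (ncomp V A))"
    proof -
      have "Suc (card (singly_crossed A - {X})) = card (singly_crossed A)"
        using 1 finite_singly_crossed by (intro card_Suc_Diff1)
      then have "real (card (singly_crossed A)) = real (card (singly_crossed ?A')) + 1"
        unfolding sc by linarith
      then show ?thesis unfolding mixed_rank_def lev by (simp add: algebra_simps)
    qed
    moreover have "(1 - lam) * (real (ncomp V ?A') - real (ncomp V A)) \<ge> (1 - lam) * 2"
      using 1 lam by (intro mult_left_mono) auto
    ultimately show ?thesis using IH cut_le[OF XL] by simp
  next
    case (2 X Y)
    let ?D = "{e. card (e \<inter> X) = 1 \<and> card (e \<inter> Y) = 1}"
    let ?A' = "A - ?D"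
    have lev: "level_edges ?A' = level_edges A"
      using 2 by (intro level_edges_Diff) (auto simp: crossed_def)
    have "crossed e \<noteq> {Z}" if "e \<in> ?D" for e Z
    proof -
      have "{X, Y} \<subseteq> crossed e" using that 2 by (auto simp: crossed_def)
      then show ?thesis using 2(3) by auto
    qed
    then have sc: "singly_crossed ?A' = singly_crossed A"
      by (auto simp: singly_crossed_def)
    have "?A' \<noteq> A" using 2(4) by fastforce
    then have "?A' \<subset> A" by auto
    then have "card ?A' < card A" using fA by (rule psubset_card_mono[rotated])
    moreover have "aligned ?A'"
      using A(2) conn_mono[of ?A' A] unfolding aligned_def lev sc by blast
    ultimately have IH: "sum x ?A' \<le> mixed_rank ?A'" using less.hyps A by blast
    have "sum x A = sum x ?A' + sum x (A \<inter> ?D)"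
      using sum.Int_Diff[OF fA, of x ?D] by simp
    moreover have "sum x (A \<inter> ?D) \<le> sum x {e \<in> complete_edges V. card (e \<inter> X) = 1 \<and> card (e \<inter> Y) = 1}"
      using A by (intro sum_x_mono) auto
    moreover have "mixed_rank A = mixed_rank ?A' + (1 - lam) * (real (ncomp V ?A') - real (ncomp V A))"
      unfolding mixed_rank_def lev sc by (simp add: algebra_simps)
    moreover have "(1 - lam) * (real (ncomp V ?A') - real (ncomp V A)) \<ge> (1 - lam) * 1"
      using 2 lam by (intro mult_left_mono) auto
    ultimately show ?thesis using IH two_cuts_le[OF 2(1-3)] by simp
  next
    case 3
    have "lam * (real (card V) - real (ncomp V A)) \<le>
      lam * (real (card V) - real (ncomp V (level_edges A)) + real (card (singly_crossed A)))"
      using 3 lam by (intro mult_left_mono) auto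
    then show ?thesis using sum_le_rank[OF A(1)] by (simp add: mixed_rank_def algebra_simps)
  qed
qed

text \<open>As long as \<open>A\<close> is not aligned, \<open>fill_region\<close> enlarges it
  without lowering the excess \<open>sum x A - mixed_rank A\<close>; for aligned sets the excess is
  at most 0.\<close>

lemma sum_le_mixed_rank:
  assumes "A \<subseteq> complete_edges V"
  shows "sum x A \<le> mixed_rank A"
  using assms
proof (induction "card (complete_edges V - A)" arbitrary: A rule: less_induct)
  case less
  show ?case
  proof (cases "aligned A")
    case True
    then show ?thesis using sum_le_mixed_rank_aligned less.prems by blast
  next
    case False
    then obtain u v where uv: "u \<in> V" "v \<in> V" "(u, v) \<in> conn A"
      "sep u v = {} \<and> (u, v) \<notin> conn (level_edges A) \<or> (\<exists>X. sep u v = {X} \<and> X \<notin> singly_crossed A)"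
      by (auto simp: aligned_def)
    obtain A' where A': "A \<subset> A'" "A' \<subseteq> complete_edges V"
      "sum x A - mixed_rank A \<le> sum x A' - mixed_rank A'"
      using fill_region[OF less.prems uv(1-3) refl uv(4)] by blast
    have "card (complete_edges V - A') < card (complete_edges V - A)"
      using A' finite_edges by (intro psubset_card_mono) auto
    then have "sum x A' \<le> mixed_rank A'" using less.hyps A' by blast
    then show ?thesis using A'(3) by linarith
  qed
qed

end

section \<open>Duality and the greedy algorithm\<close>

text \<open>The assumption \<open>dual\<close> excludes a hyperplane separating \<open>x\<close>
  from the hull of the vectors \<open>a i\<close>. Take a hull point nearest to \<open>x\<close>: if
  it differed from \<open>x\<close>, moving towards the vector that \<open>dual\<close> supplies for
  the difference would come closer.\<close>

lemma convex_combination_duality: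
  fixes a :: "'i \<Rightarrow> 'e \<Rightarrow> real" and x :: "'e \<Rightarrow> real"
  assumes "finite I" "I \<noteq> {}" "finite E"
    and dual: "\<And>c. \<exists>i\<in>I. (\<Sum>e\<in>E. c e * a i e) \<le> (\<Sum>e\<in>E. c e * x e)"
  obtains p where "\<And>i. i \<in> I \<Longrightarrow> 0 \<le> p i" "sum p I = 1"
    "\<And>e. e \<in> E \<Longrightarrow> x e = (\<Sum>i\<in>I. p i * a i e)"
proof -
  define y where "y p e = (\<Sum>i\<in>I. p i * a i e)" for p :: "'i \<Rightarrow> real" and e
  define d where "d p = (\<Sum>e\<in>E. (y p e - x e)\<^sup>2)" for p
  \<comment> \<open>Coordinates outside \<open>I\<close> are pinned to 0, which makes the box a
    product of compact sets.\<close>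
  define B where "B = (\<Pi>\<^sub>E i\<in>UNIV. if i \<in> I then {0..1::real} else {0})"
  define K where "K = B \<inter> {p. sum p I = 1}"
  have "compact B"
  proof -
    have "compactin (product_topology (\<lambda>_. euclidean) UNIV) B"
      unfolding B_def compactin_PiE by auto
    then show ?thesis by (simp add: euclidean_product_topology)
  qed
  moreover have cont_y: "continuous_on UNIV (\<lambda>p. y p e)" for e
    unfolding y_def by (intro continuous_intros continuous_on_product_coordinates)
  have "closed {p :: 'i \<Rightarrow> real. sum p I = 1}"
    by (intro closed_Collect_eq continuous_intros continuous_on_product_coordinates)
  ultimately have K: "compact K" unfolding K_def by (rule compact_Int_closed)
  obtain i0 where "i0 \<in> I" using assms by auto
  then have "(\<lambda>i. if i = i0 then 1 else 0) \<in> K"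
    using assms by (auto simp: K_def B_def PiE_iff)
  then have "K \<noteq> {}" by auto
  moreover have "continuous_on K d"
    unfolding d_def using cont_y by (intro continuous_intros continuous_on_subset[OF cont_y]) auto
  ultimately obtain p where p: "p \<in> K" "\<And>q. q \<in> K \<Longrightarrow> d p \<le> d q"
    using continuous_attains_inf[OF K] by metis
  have p0: "0 \<le> p i" "p i \<le> 1" if "i \<in> I" for i
  proof -
    have "p i \<in> (if i \<in> I then {0..1} else {0})" using p(1) unfolding K_def B_def by blast
    then show "0 \<le> p i" "p i \<le> 1" using that by auto
  qed
  have pout: "p i = 0" if "i \<notin> I" for i
  proof -
    have "p i \<in> (if i \<in> I then {0..1} else {0})" using p(1) unfolding K_def B_def by blast
    then show ?thesis using that by auto
  qed
  have p1: "sum p I = 1" using p(1) by (simp add: K_def)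
  define c where "c e = y p e - x e" for e
  obtain i where i: "i \<in> I" "(\<Sum>e\<in>E. c e * a i e) \<le> (\<Sum>e\<in>E. c e * x e)"
    using dual[of c] by auto
  define N where "N = (\<Sum>e\<in>E. (c e)\<^sup>2)"
  define Q where "Q = (\<Sum>e\<in>E. (a i e - y p e)\<^sup>2)"
  have N0: "0 \<le> N" and Q0: "0 \<le> Q" by (auto simp: N_def Q_def intro: sum_nonneg)
  have "N = 0"
  proof (rule ccontr)
    assume "N \<noteq> 0"
    then have Npos: "N > 0" using N0 by simp
    \<comment> \<open>This step length lies in \<open>{0<..1}\<close> and satisfies
      \<open>t * Q \<le> N\<close>, so the quadratic term cannot cancel the linear gain
      \<open>2 * t * N\<close>.\<close>
    define t where "t = N / (N + Q)"
    have t: "0 < t" "t \<le> 1" using Npos Q0 by (auto simp: t_def)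
    define q where "q j = (1 - t) * p j + t * (if j = i then 1 else 0)" for j
    have "q \<in> K"
    proof -
      have "sum q I = 1"
        using p1 i assms(1) by (simp add: q_def sum.distrib sum_distrib_left[symmetric])
      moreover have "0 \<le> q j" if "j \<in> I" for j using p0 t that by (simp add: q_def)
      moreover have "q j \<le> 1" if "j \<in> I" for j
      proof -
        have "(1 - t) * p j \<le> (1 - t) * 1" using p0 that t by (intro mult_left_mono) auto
        then show ?thesis using t by (auto simp: q_def)
      qed
      moreover have "q j = 0" if "j \<notin> I" for j using pout that i by (auto simp: q_def)
      ultimately show ?thesis by (auto simp: K_def B_def PiE_iff)
    qed
    then have "d p \<le> d q" by (rule p(2))
    have yq: "y q e = y p e + t * (a i e - y p e)" for e
    proof -
      have "y q e = (\<Sum>j\<in>I. (1 - t) * (p j * a j e) + (if j = i then t * a i e else 0))"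
        unfolding y_def q_def by (intro sum.cong) (auto simp: algebra_simps)
      also have "\<dots> = (1 - t) * y p e + t * a i e"
        using i assms(1) by (simp add: sum.distrib y_def sum_distrib_left)
      finally show ?thesis by (simp add: algebra_simps)
    qed
    have "d q = (\<Sum>e\<in>E. (c e)\<^sup>2 + 2 * t * (c e * a i e - c e * x e - (c e)\<^sup>2) + t\<^sup>2 * (a i e - y p e)\<^sup>2)"
      unfolding d_def yq by (intro sum.cong) (auto simp: c_def power2_eq_square algebra_simps)
    also have "\<dots> = N + 2 * t * ((\<Sum>e\<in>E. c e * a i e) - (\<Sum>e\<in>E. c e * x e) - N) + t\<^sup>2 * Q"
      by (simp add: sum.distrib sum_subtractf N_def Q_def sum_distrib_left[symmetric])
    also have "\<dots> \<le> N + 2 * t * (- N) + t\<^sup>2 * Q"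
      using i t by (intro add_mono mult_left_mono) auto
    also have "t\<^sup>2 * Q \<le> t * N"
    proof -
      have "t * Q \<le> N" using Npos Q0 by (simp add: t_def field_simps)
      then have "t * (t * Q) \<le> t * N" using t by (intro mult_left_mono) auto
      then show ?thesis by (simp add: power2_eq_square mult.assoc)
    qed
    finally have "d q \<le> N - t * N" by (simp add: algebra_simps)
    moreover have "d p = N" by (simp add: d_def N_def c_def)
    moreover have "t * N > 0" using t Npos by simp
    ultimately show False using \<open>d p \<le> d q\<close> by linarith
  qed
  then have "c e = 0" if "e \<in> E" for e
    using that assms(3) unfolding N_def by (simp add: sum_nonneg_eq_0_iff)
  then have "x e = (\<Sum>i\<in>I. p i * a i e)" if "e \<in> E" for e
    using that by (simp add: c_def y_def)
  then show ?thesis using that p0 p1 by blast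
qed

text \<open>Summation by parts over the values of \<open>c\<close>: lowering the largest value
  \<open>M\<close> to the next one \<open>M'\<close> decreases the sum by \<open>M - M'\<close>
  times the weight of the top elements. That weight is nonnegative, because the other elements have
  weight at most 0 and the total is 0.\<close>

lemma sum_nonneg_if_thresholds:
  fixes c w :: "'e \<Rightarrow> real"
  assumes "finite E" "sum w E = 0" "\<And>g. g \<in> c ` E \<Longrightarrow> sum w {e \<in> E. c e \<le> g} \<le> 0"
  shows "0 \<le> (\<Sum>e\<in>E. c e * w e)"
  using assms(3)
proof (induction "card (c ` E)" arbitrary: c rule: less_induct)
  case less
  show ?case
  proof (cases "E = {}")
    case False
    define M where "M = Max (c ` E)"
    have M: "M \<in> c ` E" "\<And>e. e \<in> E \<Longrightarrow> c e \<le> M"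
      using assms(1) False by (auto simp: M_def)
    show ?thesis
    proof (cases "c ` E - {M} = {}")
      case True
      then have "c e = M" if "e \<in> E" for e using that by blast
      then have "(\<Sum>e\<in>E. c e * w e) = M * sum w E" by (simp add: sum_distrib_left)
      then show ?thesis using assms(2) by simp
    next
      case ne: False
      define M' where "M' = Max (c ` E - {M})"
      have M': "M' \<in> c ` E - {M}" unfolding M'_def using assms(1) ne by (intro Max_in) auto
      have le: "c e \<le> M'" if "e \<in> E" "c e \<noteq> M" for e
        unfolding M'_def using assms(1) that by (intro Max_ge) auto
      have "M' < M" using M' M by force
      define c' where "c' e = min (c e) M'" for e
      have c'e: "c' e = (if c e = M then M' else c e)" if "e \<in> E" for e
        using le[OF that] \<open>M' < M\<close> by (auto simp: c'_def)
      have im: "c' ` E \<subseteq> c ` E - {M}"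
        using c'e M' by auto
      then have "c' ` E \<subset> c ` E" using M by blast
      then have "card (c' ` E) < card (c ` E)" using assms(1) by (intro psubset_card_mono) auto
      \<comment> \<open>Thresholds below \<open>M'\<close> select the same sets for
        \<open>c'\<close> as for \<open>c\<close>, and \<open>M'\<close> itself selects all of
        \<open>E\<close>.\<close>
      moreover have "sum w {e \<in> E. c' e \<le> g} \<le> 0" if "g \<in> c' ` E" for g
      proof (cases "g = M'")
        case True
        then have "{e \<in> E. c' e \<le> g} = E" by (auto simp: c'_def)
        then show ?thesis using assms(2) by simp
      next
        case False
        have g: "g \<in> c ` E" "g \<noteq> M" using im that by auto
        then have "g < M'" using le False by force
        then have "{e \<in> E. c' e \<le> g} = {e \<in> E. c e \<le> g}" by (auto simp: c'_def)
        then show ?thesis using less.prems g by simp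
      qed
      ultimately have IH: "0 \<le> (\<Sum>e\<in>E. c' e * w e)" by (rule less.hyps)
      let ?D = "{e \<in> E. c e \<le> M'}"
      have "(\<Sum>e\<in>E. c e * w e) - (\<Sum>e\<in>E. c' e * w e) = (\<Sum>e\<in>E. (if c e \<le> M' then 0 else (M - M') * w e))"
        unfolding sum_subtractf[symmetric]
      proof (rule sum.cong)
        fix e assume "e \<in> E"
        then show "c e * w e - c' e * w e = (if c e \<le> M' then 0 else (M - M') * w e)"
          using c'e[of e] le[of e] \<open>M' < M\<close> by (auto simp: algebra_simps)
      qed simp
      also have "\<dots> = (M - M') * sum w (E - ?D)"
        unfolding sum_distrib_left using assms(1)
        by (intro sum.mono_neutral_cong_right) auto
      also have "sum w (E - ?D) = - sum w ?D"
        using assms by (simp add: sum_diff)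
      also have "(M - M') * - sum w ?D \<ge> 0"
        using less.prems[of M'] M' \<open>M' < M\<close> by (simp add: mult_nonneg_nonpos)
      finally show ?thesis using IH by linarith
    qed
  qed simp
qed

section \<open>Minimum-cost trees over a chain of cuts\<close>

context cut_chain
begin

definition trees :: "'a set set set" where
  "trees = {T. is_tree V T}"

definition single_crossing_trees :: "'a set set set" where
  "single_crossing_trees = {T. is_tree V T \<and> (\<forall>X\<in>L. card (cut V X \<inter> T) = 1)}"

lemma finite_trees: "finite trees"
  by (rule finite_subset[of _ "Pow (complete_edges V)"])
    (use finite_V finite_complete_edges in \<open>auto simp: trees_def is_tree_def\<close>)

lemma single_crossing_subset: "single_crossing_trees \<subseteq> trees"
  by (auto simp: trees_def single_crossing_trees_def)

text \<open>A Hamiltonian path in which every set of the chain is a prefix.\<close>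
lemma single_crossing_tree_exists: "single_crossing_trees \<noteq> {}"
proof -
  \<comment> \<open>The number of sets missing a vertex is the index of its level, counted from the
    innermost set.\<close>
  define key where "key v = card {X \<in> L. v \<notin> X}" for v
  obtain xs where xs: "set xs = V" "distinct xs" using finite_V finite_distinct_list by blast
  define ys where "ys = sort_key key xs"
  have ys: "set ys = V" "distinct ys" "sorted (map key ys)" using xs by (auto simp: ys_def)
  let ?n = "length ys"
  have n: "?n = card V" using ys distinct_card by fastforce
  then have npos: "?n > 0" using finite_V V_nonempty by (simp add: card_gt_0_iff)
  define T where "T = (\<lambda>i. {ys ! i, ys ! Suc i}) ` {..<?n - 1}"
  have TE: "T \<subseteq> complete_edges V"
    using ys nth_eq_iff_index_eq[OF ys(2)] by (auto simp: T_def complete_edges_iff)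
  have "card T \<le> ?n - 1" unfolding T_def using card_image_le[of "{..<?n - 1}"] by simp
  then have cT: "card T + 1 \<le> card V" using n npos by linarith
  have path: "i < ?n \<Longrightarrow> (ys ! 0, ys ! i) \<in> conn T" for i
  proof (induction i)
    case (Suc i)
    then have "{ys ! i, ys ! Suc i} \<in> T" by (auto simp: T_def)
    then show ?case using Suc by (meson Suc_lessD conn_edge conn_trans)
  qed simp
  have "(u, v) \<in> conn T" if uv: "u \<in> V" "v \<in> V" for u v
  proof -
    obtain i j where "u = ys ! i" "i < ?n" "v = ys ! j" "j < ?n"
      using uv ys(1) by (metis in_set_conv_nth)
    then show ?thesis using path[of i] path[of j] by (meson conn_sym conn_trans)
  qed
  then have tree: "is_tree V T" using TE cT finite_V V_nonempty by (intro is_treeI)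
  have "card (cut V X \<inter> T) = 1" if X: "X \<in> L" for X
  proof -
    have down: "w \<in> X" if "u \<in> X" "key w \<le> key u" for u w
    proof (rule ccontr)
      assume w: "w \<notin> X"
      have "{Y \<in> L. u \<notin> Y} \<subseteq> {Y \<in> L. w \<notin> Y}"
        using chain[OF X] \<open>u \<in> X\<close> w by blast
      moreover have "X \<in> {Y \<in> L. w \<notin> Y}" "X \<notin> {Y \<in> L. u \<notin> Y}" using X w \<open>u \<in> X\<close> by auto
      ultimately have "{Y \<in> L. u \<notin> Y} \<subset> {Y \<in> L. w \<notin> Y}" by blast
      then have "key u < key w" unfolding key_def using finite_L by (intro psubset_card_mono) auto
      then show False using that by simp
    qed
    have prefix: "ys ! j \<in> X" if "ys ! i \<in> X" "j \<le> i" "i < ?n" for i j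
    proof (rule down)
      show "ys ! i \<in> X" using that by simp
      have "map key ys ! j \<le> map key ys ! i" using ys(3) that by (intro sorted_nth_mono) auto
      then show "key (ys ! j) \<le> key (ys ! i)" using that by simp
    qed
    obtain v where "v \<in> V" "v \<notin> X" using proper[OF X] by auto
    then obtain m where m: "m < ?n" "ys ! m \<notin> X" using ys(1) by (metis in_set_conv_nth)
    define k where "k = (LEAST i. ys ! i \<notin> X)"
    have k: "ys ! k \<notin> X" "k \<le> m"
      unfolding k_def using LeastI[of "\<lambda>i. ys ! i \<notin> X" m] Least_le[of "\<lambda>i. ys ! i \<notin> X" m] m by simp_all
    have kX: "ys ! i \<in> X \<longleftrightarrow> i < k" if "i < ?n" for i
    proof
      show "i < k" if "ys ! i \<in> X" using k(1) prefix[OF that] \<open>i < ?n\<close> by (meson not_le)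
      show "ys ! i \<in> X" if "i < k" using not_less_Least[OF that[unfolded k_def]] by simp
    qed
    obtain u where "u \<in> X" "u \<in> V" using proper[OF X] by auto
    then obtain l where "l < ?n" "ys ! l \<in> X" using ys(1) by (metis in_set_conv_nth)
    then have kpos: "k > 0" using kX by fastforce
    have kn: "k < ?n" using k m by simp
    have "cut V X \<inter> T = {{ys ! (k - 1), ys ! k}}"
    proof (intro equalityI subsetI)
      fix e assume e: "e \<in> cut V X \<inter> T"
      then obtain i where i: "i < ?n - 1" "e = {ys ! i, ys ! Suc i}" by (auto simp: T_def)
      then have "ys ! i \<noteq> ys ! Suc i" using nth_eq_iff_index_eq[OF ys(2)] by auto
      then have "(ys ! i \<in> X) \<noteq> (ys ! Suc i \<in> X)" using e i by (simp add: cut_def card_pair_Int)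
      then have "Suc i = k" using kX[of i] kX[of "Suc i"] i by auto
      then show "e \<in> {{ys ! (k - 1), ys ! k}}" using i by auto
    next
      fix e assume "e \<in> {{ys ! (k - 1), ys ! k}}"
      then have e: "e = {ys ! (k - 1), ys ! Suc (k - 1)}" using kpos by simp
      have "k - 1 < ?n - 1" using kn kpos by simp
      then have eT: "e \<in> T" unfolding T_def e by blast
      moreover have "ys ! (k - 1) \<noteq> ys ! k" using nth_eq_iff_index_eq[OF ys(2)] kn kpos by auto
      then have "card (e \<inter> X) = 1"
        using kX[of "k - 1"] kX[of k] kn kpos e by (simp add: card_pair_Int)
      ultimately show "e \<in> cut V X \<inter> T" using TE by (auto simp: cut_def)
    qed
    then show ?thesis by simp
  qed
  then have "T \<in> single_crossing_trees" using tree by (simp add: single_crossing_trees_def)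
  then show ?thesis by blast
qed

lemma tree_crosses:
  assumes "is_tree V T" "X \<in> L"
  shows "1 \<le> card (cut V X \<inter> T)"
proof -
  obtain u v where uv: "u \<in> X" "v \<in> V" "v \<notin> X" "u \<in> V" using proper[OF assms(2)] by blast
  then have "(u, v) \<in> conn T" using assms by (auto simp: is_tree_def)
  then obtain a b where ab: "{a, b} \<in> T" "a \<in> X" "b \<notin> X"
    using conn_leaves[of u v T "\<lambda>w. w \<in> X"] uv by blast
  then have "{a, b} \<in> cut V X \<inter> T"
    using assms card_pair_Int[of a b X] by (auto simp: cut_def is_tree_def)
  moreover have "finite (cut V X \<inter> T)" using is_tree_finite[OF assms(1) finite_V] by simp
  ultimately show ?thesis by (metis One_nat_def Suc_leI card_gt_0_iff empty_iff)
qed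

text \<open>Double counting; it turns a charge per edge crossing into a charge per cut.\<close>

lemma sum_card_crossed:
  assumes "T \<subseteq> complete_edges V"
  shows "(\<Sum>e\<in>T. card (crossed e)) = (\<Sum>X\<in>L. card (cut V X \<inter> T))"
proof -
  have fT: "finite T" using finite_edges assms .
  have "{e \<in> T. card (e \<inter> X) = 1} = cut V X \<inter> T" for X
    using assms by (auto simp: cut_def)
  then show ?thesis
    unfolding crossed_def using fT finite_L by (intro sum_multicount_gen) auto
qed

text \<open>An ordinary minimum tree for the cost \<open>c'\<close>, which charges \<open>M\<close>
  per crossed set, crosses each set once. For a threshold set \<open>A\<close>, its edges of
  \<open>c'\<close>-cost at most \<open>g\<close> connect what the level edges of \<open>A\<close>
  connect, and its edges of cost at most \<open>M + g\<close> supply one edge for every singly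
  crossed set.\<close>

lemma min_single_crossing_tree:
  fixes c :: "'a set \<Rightarrow> real"
  obtains T where "T \<in> single_crossing_trees"
    "\<And>g. g \<in> c ` complete_edges V \<Longrightarrow>
      real (card V) - real (ncomp V (level_edges {e \<in> complete_edges V. c e \<le> g}))
        + real (card (singly_crossed {e \<in> complete_edges V. c e \<le> g}))
      \<le> real (card (T \<inter> {e \<in> complete_edges V. c e \<le> g}))"
proof -
  let ?E = "complete_edges V"
  have fE: "finite ?E" using finite_complete_edges finite_V .
  define C where "C = (\<Sum>e\<in>?E. \<bar>c e\<bar>)"
  \<comment> \<open>The \<open>c\<close>-costs of two edge sets differ by at most
    \<open>2 * C\<close>, so saving a single crossing outweighs any such difference.\<close>
  define M where "M = 2 * C + 1"
  define c' where "c' e = M * real (card (crossed e)) + c e" for e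
  have C: "\<bar>c e\<bar> \<le> C" if "e \<in> ?E" for e
    unfolding C_def using fE that by (intro member_le_sum) auto
  have C0: "0 \<le> C" unfolding C_def by (intro sum_nonneg) auto
  obtain T where T: "T \<in> trees" "\<And>T'. T' \<in> trees \<Longrightarrow> sum c' T \<le> sum c' T'"
  proof -
    have "trees \<noteq> {}" using single_crossing_tree_exists single_crossing_subset by auto
    then show ?thesis
      using finite_trees that ex_min_if_finite[of "sum c' ` trees"]
      by (metis (no_types, lifting) arg_min_if_finite(1) arg_min_least)
  qed
  have tree: "is_tree V T" using T by (simp add: trees_def)
  then have TE: "T \<subseteq> ?E" by (simp add: is_tree_def)
  have cb: "\<bar>sum c S\<bar> \<le> C" if "S \<subseteq> ?E" for S
  proof -
    have "\<bar>sum c S\<bar> \<le> (\<Sum>e\<in>S. \<bar>c e\<bar>)" by (rule sum_abs)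
    also have "\<dots> \<le> C" unfolding C_def using that fE by (intro sum_mono2) auto
    finally show ?thesis .
  qed
  have c'sum: "sum c' S = M * real (\<Sum>X\<in>L. card (cut V X \<inter> S)) + sum c S" if "S \<subseteq> ?E" for S
    unfolding sum_card_crossed[OF that, symmetric]
    by (simp add: c'_def sum.distrib sum_distrib_left)
  obtain G where G: "G \<in> single_crossing_trees" using single_crossing_tree_exists by auto
  then have GE: "G \<subseteq> ?E" and GT: "G \<in> trees" and "(\<Sum>X\<in>L. card (cut V X \<inter> G)) = card L"
    using single_crossing_subset by (auto simp: single_crossing_trees_def is_tree_def)
  \<comment> \<open>Minimality against \<open>G\<close> bounds the total number of crossings of
    \<open>T\<close> by \<open>card L\<close>, and every set is crossed at least once.\<close>
  then have "M * real (\<Sum>X\<in>L. card (cut V X \<inter> T)) + sum c T \<le> M * real (card L) + sum c G"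
    using T(2)[OF GT] c'sum[OF TE] c'sum[OF GE] by simp
  then have "M * (real (\<Sum>X\<in>L. card (cut V X \<inter> T)) - real (card L)) < M * 1"
    using cb[OF TE] cb[OF GE] unfolding M_def by (simp add: algebra_simps)
  then have "real (\<Sum>X\<in>L. card (cut V X \<inter> T)) - real (card L) < 1"
    using C0 by (simp add: M_def mult_less_cancel_left del: of_nat_sum)
  then have "(\<Sum>X\<in>L. card (cut V X \<inter> T)) \<le> card L" by linarith
  then have le: "(\<Sum>X\<in>L. card (cut V X \<inter> T)) \<le> (\<Sum>X\<in>L. 1)" by simp
  have cross1: "card (cut V X \<inter> T) = 1" if "X \<in> L" for X
  proof (rule ccontr)
    assume "card (cut V X \<inter> T) \<noteq> 1"
    then have "1 < card (cut V X \<inter> T)" using tree_crosses[OF tree that] by simp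
    then have "(\<Sum>X\<in>L. 1) < (\<Sum>X\<in>L. card (cut V X \<inter> T))"
      using tree_crosses[OF tree] finite_L that by (intro sum_strict_mono_ex1) auto
    then show False using le by simp
  qed
  have minT: "sum c' T \<le> sum c' T'" if "is_tree V T'" for T' using T that by (simp add: trees_def)
  have conn_T: "(u, v) \<in> conn {e \<in> T. c' e \<le> h}" if "(u, v) \<in> conn {e \<in> ?E. c' e \<le> h}" for u v h
    using finite_V tree minT that by (rule min_cost_tree_conn)
  have "real (card V) - real (ncomp V (level_edges A)) + real (card (singly_crossed A))
      \<le> real (card (T \<inter> A))" if g: "g \<in> c ` ?E" and A: "A = {e \<in> ?E. c e \<le> g}" for g A
  proof -
    have gC: "\<bar>g\<bar> \<le> C" using g C by auto
    have M2: "M > g - c e" if "e \<in> ?E" for e using C[OF that] gC by (simp add: M_def)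
    have big: "M * real k \<ge> M" if "k \<ge> 1" for k :: nat
      using that C0 by (simp add: M_def mult_le_cancel_left1)
    \<comment> \<open>An edge crossing some set costs at least \<open>M + c e\<close>, which exceeds
      \<open>g\<close>.\<close>
    have low: "{e \<in> ?E. c' e \<le> g} = level_edges A"
    proof -
      have "c' e \<le> g \<longleftrightarrow> crossed e = {} \<and> c e \<le> g" if "e \<in> ?E" for e
      proof (cases "crossed e = {}")
        case False
        then have "card (crossed e) \<ge> 1" using finite_L by (simp add: crossed_def Suc_le_eq card_gt_0_iff)
        then show ?thesis using big[of "card (crossed e)"] M2[OF that] False by (simp add: c'_def)
      qed (simp add: c'_def)
      then show ?thesis by (auto simp: level_edges_def A)
    qed
    have "ncomp V (T \<inter> level_edges A) \<le> ncomp V (level_edges A)"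
    proof (rule ncomp_antimono_conn[OF finite_V])
      fix u v assume "(u, v) \<in> conn (level_edges A)"
      then have "(u, v) \<in> conn {e \<in> ?E. c' e \<le> g}" unfolding low .
      then have "(u, v) \<in> conn {e \<in> T. c' e \<le> g}"
        by (rule conn_T)
      moreover have "{e \<in> T. c' e \<le> g} \<subseteq> T \<inter> level_edges A" using low TE by auto
      ultimately show "(u, v) \<in> conn (T \<inter> level_edges A)" by (rule conn_mono[rotated])
    qed
    moreover have "ncomp V (T \<inter> level_edges A) + card (T \<inter> level_edges A) = card V"
      by (rule tree_ncomp[OF finite_V tree]) auto
    ultimately have 1: "card V \<le> ncomp V (level_edges A) + card (T \<inter> level_edges A)" by linarith
    \<comment> \<open>Tree edges of cost at most \<open>M + g\<close> join the ends of an edge of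
      \<open>A\<close> that crosses only \<open>X\<close>, so one of them crosses \<open>X\<close>.
      A second crossing would push its cost above \<open>M + g\<close>.\<close>
    have "\<exists>f. f \<in> T \<inter> A \<and> crossed f = {X}" if X: "X \<in> singly_crossed A" for X
    proof -
      obtain e where e: "e \<in> A" "crossed e = {X}" using X by (auto simp: singly_crossed_def)
      have eE: "e \<in> ?E" "c e \<le> g" using e A by auto
      obtain a b where ab: "e = {a, b}" "a \<noteq> b" using eE(1) by (rule complete_edgesE)
      have "c' e \<le> M + g" using e eE by (simp add: c'_def)
      then have "(a, b) \<in> conn {e \<in> ?E. c' e \<le> M + g}" using eE ab by (intro conn_edge) auto
      then have "(a, b) \<in> conn {e \<in> T. c' e \<le> M + g}"
        by (rule conn_T)
      moreover have "X \<in> sep a b" using e ab crossed_pair by simp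
      then have "(a \<in> X) \<noteq> (b \<in> X)" "X \<in> L" by (auto simp: sep_def)
      ultimately obtain p q where pq: "{p, q} \<in> {e \<in> T. c' e \<le> M + g}" "(p \<in> X) \<noteq> (q \<in> X)"
        using conn_leaves[of a b _ "\<lambda>w. (w \<in> X) = (a \<in> X)"] by (metis (mono_tags, lifting))
      let ?f = "{p, q}"
      have fT: "?f \<in> T" "c' ?f \<le> M + g" using pq by auto
      then have fE: "?f \<in> ?E" using TE by auto
      have "X \<in> crossed ?f" using pq(2) \<open>X \<in> L\<close> card_pair_Int[of p q X] by (auto simp: crossed_def)
      moreover have fin: "finite (crossed ?f)" using finite_L by (simp add: crossed_def)
      moreover have "card (crossed ?f) \<le> 1"
      proof (rule ccontr)
        assume "\<not> ?thesis"
        then have "real (card (crossed ?f)) \<ge> 2" by simp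
        then have "M * real (card (crossed ?f)) \<ge> M * 2" using C0 by (intro mult_left_mono) (auto simp: M_def)
        then show False using fT M2[OF fE] by (simp add: c'_def)
      qed
      ultimately have f1: "crossed ?f = {X}"
        by (metis One_nat_def card_1_singletonE card_gt_0_iff empty_iff le_antisym Suc_leI singletonD)
      then have "c ?f \<le> g" using fT by (simp add: c'_def)
      then show ?thesis using f1 fT fE A by auto
    qed
    then obtain h where h: "\<And>X. X \<in> singly_crossed A \<Longrightarrow> h X \<in> T \<inter> A \<and> crossed (h X) = {X}" by metis
    have fT: "finite T" using is_tree_finite tree finite_V by blast
    have "inj_on h (singly_crossed A)"
      using h by (intro inj_onI) (metis singleton_inject)
    then have "card (singly_crossed A) = card (h ` singly_crossed A)" by (simp add: card_image)
    moreover have "h ` singly_crossed A \<inter> (T \<inter> level_edges A) = {}"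
      using h by (auto simp: level_edges_def)
    moreover have "finite (h ` singly_crossed A)" using finite_singly_crossed by simp
    ultimately have "card (singly_crossed A) + card (T \<inter> level_edges A)
        = card (h ` singly_crossed A \<union> (T \<inter> level_edges A))"
      using fT by (simp add: card_Un_disjoint)
    also have "\<dots> \<le> card (T \<inter> A)"
      using fT h level_edges_subset by (intro card_mono) auto
    finally show ?thesis using 1 by linarith
  qed
  then show ?thesis using that[of T] tree cross1 by (auto simp: single_crossing_trees_def)
qed

text \<open>The same greedy bound for the graphic matroid, without a charge for crossings.\<close>

lemma min_tree:
  fixes c :: "'a set \<Rightarrow> real"
  obtains T where "T \<in> trees"
    "\<And>g. real (card V) - real (ncomp V {e \<in> complete_edges V. c e \<le> g})
      \<le> real (card (T \<inter> {e \<in> complete_edges V. c e \<le> g}))"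
proof -
  obtain T where T: "T \<in> trees" "\<And>T'. T' \<in> trees \<Longrightarrow> sum c T \<le> sum c T'"
  proof -
    have "trees \<noteq> {}" using single_crossing_tree_exists single_crossing_subset by auto
    then show ?thesis
      using finite_trees that by (metis (no_types, lifting) arg_min_if_finite(1) arg_min_least)
  qed
  have tree: "is_tree V T" using T by (simp add: trees_def)
  have minT: "sum c T \<le> sum c T'" if "is_tree V T'" for T' using T that by (simp add: trees_def)
  have conn_T: "(u, v) \<in> conn {e \<in> T. c e \<le> h}" if "(u, v) \<in> conn {e \<in> complete_edges V. c e \<le> h}" for u v h
    using finite_V tree minT that by (rule min_cost_tree_conn)
  have "real (card V) - real (ncomp V A) \<le> real (card (T \<inter> A))"
    if A: "A = {e \<in> complete_edges V. c e \<le> g}" for A g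
  proof -
    have "ncomp V (T \<inter> A) \<le> ncomp V A"
    proof (rule ncomp_antimono_conn[OF finite_V])
      fix u v assume "(u, v) \<in> conn A"
      then have "(u, v) \<in> conn {e \<in> T. c e \<le> g}"
        unfolding A by (rule conn_T)
      moreover have "{e \<in> T. c e \<le> g} \<subseteq> T \<inter> A" using A tree by (auto simp: is_tree_def)
      ultimately show "(u, v) \<in> conn (T \<inter> A)" by (rule conn_mono[rotated])
    qed
    moreover have "ncomp V (T \<inter> A) + card (T \<inter> A) = card V"
      by (rule tree_ncomp[OF finite_V tree]) auto
    ultimately show ?thesis by linarith
  qed
  from this[OF refl] show ?thesis by (rule that[OF T(1)])
qed

end

section \<open>Splitting a point into two mixtures of trees\<close>

context slack_point
begin

text \<open>Taking pairs of trees as indices turns the weighted sum of two hulls into a single hull.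
  For a cost \<open>c\<close> the two greedy trees attain at least the two ranks on every threshold
  set, so \<open>sum_le_mixed_rank\<close> yields the condition of the duality lemma.\<close>

lemma split_into_trees:
  obtains p q where "\<And>T. T \<in> single_crossing_trees \<Longrightarrow> 0 \<le> p T" "sum p single_crossing_trees = 1"
    "\<And>T. T \<in> trees \<Longrightarrow> 0 \<le> q T" "sum q trees = 1"
    "\<And>e. e \<in> complete_edges V \<Longrightarrow> x e = lam * (\<Sum>T\<in>single_crossing_trees. p T * indicator T e)
      + (1 - lam) * (\<Sum>T\<in>trees. q T * indicator T e)"
proof -
  let ?E = "complete_edges V" and ?G = single_crossing_trees
  let ?a = "\<lambda>(S, T) e. lam * indicator S e + (1 - lam) * indicator T e :: real"
  have fE: "finite ?E" using finite_complete_edges finite_V .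
  have fG: "finite ?G" using finite_trees single_crossing_subset finite_subset by blast
  have ne: "?G \<noteq> {}" "trees \<noteq> {}" using single_crossing_tree_exists single_crossing_subset by auto
  have xE: "sum x ?E = real (card V) - 1" using deficit_V by (simp add: deficit_def)
  have ind: "(\<Sum>e\<in>A. indicator S e) = real (card (S \<inter> A))" if "A \<subseteq> ?E" for A S :: "'a set set"
    using finite_edges[OF that] by (simp add: indicator_def sum.If_cases Int_commute)
  have "\<exists>ST\<in>?G \<times> trees. (\<Sum>e\<in>?E. c e * ?a ST e) \<le> (\<Sum>e\<in>?E. c e * x e)" for c
  proof -
    obtain S where S: "S \<in> ?G" and S_le: "\<And>g. g \<in> c ` ?E \<Longrightarrow>
      real (card V) - real (ncomp V (level_edges {e \<in> ?E. c e \<le> g}))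
        + real (card (singly_crossed {e \<in> ?E. c e \<le> g})) \<le> real (card (S \<inter> {e \<in> ?E. c e \<le> g}))"
      using min_single_crossing_tree by blast
    obtain T where T: "T \<in> trees" and T_le: "\<And>g. real (card V) - real (ncomp V {e \<in> ?E. c e \<le> g})
      \<le> real (card (T \<inter> {e \<in> ?E. c e \<le> g}))"
      using min_tree by blast
    define w where "w e = x e - ?a (S, T) e" for e
    have wsum: "sum w A = sum x A - lam * real (card (S \<inter> A)) - (1 - lam) * real (card (T \<inter> A))"
      if "A \<subseteq> ?E" for A
      using ind[OF that] by (simp add: w_def sum_subtractf sum.distrib sum_distrib_left[symmetric])
    have "is_tree V S" "is_tree V T" using S T by (auto simp: trees_def single_crossing_trees_def)
    then have "S \<inter> ?E = S" "T \<inter> ?E = T"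
      "real (card S) = real (card V) - 1" "real (card T) = real (card V) - 1"
      by (auto simp: is_tree_def)
    then have "real (card (S \<inter> ?E)) = real (card V) - 1" "real (card (T \<inter> ?E)) = real (card V) - 1"
      by simp_all
    then have "sum w ?E = 0" unfolding wsum[OF order_refl] xE by (simp only:) (simp add: algebra_simps)
    moreover have "sum w {e \<in> ?E. c e \<le> g} \<le> 0" if "g \<in> c ` ?E" for g
    proof -
      let ?A = "{e \<in> ?E. c e \<le> g}"
      have "sum x ?A \<le> mixed_rank ?A" by (rule sum_le_mixed_rank) auto
      also have "\<dots> \<le> lam * real (card (S \<inter> ?A)) + (1 - lam) * real (card (T \<inter> ?A))"
        unfolding mixed_rank_def using S_le[OF that] T_le[of g] lam
        by (intro add_mono mult_left_mono) auto
      finally show ?thesis using wsum[of ?A] by auto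
    qed
    ultimately have "0 \<le> (\<Sum>e\<in>?E. c e * w e)" using fE by (intro sum_nonneg_if_thresholds)
    then have "(\<Sum>e\<in>?E. c e * ?a (S, T) e) \<le> (\<Sum>e\<in>?E. c e * x e)"
      by (simp add: w_def right_diff_distrib sum_subtractf)
    then show ?thesis using S T by (intro bexI[of _ "(S, T)"]) auto
  qed
  then obtain r where r: "\<And>ST. ST \<in> ?G \<times> trees \<Longrightarrow> 0 \<le> r ST" "sum r (?G \<times> trees) = 1"
    "\<And>e. e \<in> ?E \<Longrightarrow> x e = (\<Sum>ST\<in>?G \<times> trees. r ST * ?a ST e)"
    using convex_combination_duality[of "?G \<times> trees" ?E ?a x] fG finite_trees ne fE by auto
  \<comment> \<open>The two families of weights are the marginals of the weights on pairs.\<close>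
  define p where "p S = (\<Sum>T\<in>trees. r (S, T))" for S
  define q where "q T = (\<Sum>S\<in>?G. r (S, T))" for T
  have "x e = lam * (\<Sum>T\<in>?G. p T * indicator T e) + (1 - lam) * (\<Sum>T\<in>trees. q T * indicator T e)"
    if "e \<in> ?E" for e
  proof -
    have "x e = (\<Sum>S\<in>?G. \<Sum>T\<in>trees. r (S, T) * ?a (S, T) e)"
      using r(3)[OF that] by (simp add: sum.cartesian_product split_def)
    also have "\<dots> = lam * (\<Sum>S\<in>?G. \<Sum>T\<in>trees. r (S, T) * indicator S e)
        + (1 - lam) * (\<Sum>S\<in>?G. \<Sum>T\<in>trees. r (S, T) * indicator T e)"
      by (simp add: sum_distrib_left sum.distrib[symmetric] algebra_simps)
    also have "(\<Sum>S\<in>?G. \<Sum>T\<in>trees. r (S, T) * indicator T e) = (\<Sum>T\<in>trees. \<Sum>S\<in>?G. r (S, T) * indicator T e)"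
      by (rule sum.swap)
    finally show ?thesis by (simp add: p_def q_def sum_distrib_right)
  qed
  moreover have "sum p ?G = 1" "sum q trees = 1"
    using r(2) sum.swap[of "\<lambda>S T. r (S, T)" trees ?G] by (simp_all add: p_def q_def sum.cartesian_product)
  moreover have "0 \<le> p T" if "T \<in> ?G" for T using r(1) that by (auto simp: p_def intro: sum_nonneg)
  moreover have "0 \<le> q T" if "T \<in> trees" for T using r(1) that by (auto simp: q_def intro: sum_nonneg)
  ultimately show ?thesis using that by blast
qed

end

section \<open>Peeling off layers\<close>

lemma sum_inter_indicator:
  assumes "finite A"
  shows "(\<Sum>e\<in>A. indicator S e) = real (card (S \<inter> A))"
  using assms by (simp add: indicator_def sum.If_cases Int_commute)

lemma sum_mixture:
  fixes q :: "'b set \<Rightarrow> real"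
  assumes "finite A"
  shows "(\<Sum>e\<in>A. \<Sum>T\<in>G. q T * indicator T e) = (\<Sum>T\<in>G. q T * real (card (T \<inter> A)))"
  by (subst sum.swap) (simp add: sum_distrib_left[symmetric] sum_inter_indicator[OF assms])

text \<open>One edge runs across, neither side can hold more edges than a tree on it, and the total
  number of edges forces both sides to be full. Both sides thus have deficit 1, which keeps cuts
  balanced when such trees are split off.\<close>

lemma (in cut_chain) single_crossing_card:
  assumes T: "T \<in> single_crossing_trees" and X: "X \<in> L"
  shows "card (T \<inter> complete_edges X) + 1 = card X"
    "card (T \<inter> complete_edges (V - X)) + 1 = card (V - X)"
proof -
  have tree: "is_tree V T" and c1: "card (cut V X \<inter> T) = 1"
    using T X by (auto simp: single_crossing_trees_def)
  have TE: "T \<subseteq> complete_edges V" and cT: "card T + 1 = card V" using tree by (auto simp: is_tree_def)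
  have XV: "X \<subseteq> V" "X \<noteq> {}" "V - X \<noteq> {}" using proper[OF X] by auto
  have fin: "finite (complete_edges U)" if "U \<subseteq> V" for U
    using that finite_V finite_complete_edges finite_subset by metis
  have "real (card (T \<inter> complete_edges V)) = real (card (T \<inter> complete_edges X))
    + real (card (T \<inter> complete_edges (V - X))) + real (card (T \<inter> cut V X))"
    using sum_cut_split[OF finite_V XV(1), of "indicator T"] fin[of V] fin[of X] fin[of "V - X"] XV
    by (simp add: sum_inter_indicator cut_def)
  moreover have "T \<inter> complete_edges V = T" "T \<inter> cut V X = cut V X \<inter> T" using TE by auto
  ultimately have "card T = card (T \<inter> complete_edges X) + card (T \<inter> complete_edges (V - X)) + 1"
    using c1 by simp
  moreover have "card (T \<inter> complete_edges X) + 1 \<le> card X"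
    using tree_card_complete[OF finite_V tree] XV by blast
  moreover have "card (T \<inter> complete_edges (V - X)) + 1 \<le> card (V - X)"
    using tree_card_complete[OF finite_V tree, of "V - X"] XV by blast
  moreover have "card X + card (V - X) = card V"
    using XV finite_V by (metis card_Diff_subset card_mono finite_subset le_add_diff_inverse)
  ultimately show "card (T \<inter> complete_edges X) + 1 = card X"
    "card (T \<inter> complete_edges (V - X)) + 1 = card (V - X)"
    using cT by linarith+
qed

text \<open>Members of weight 0 are dropped, because the listed weights have to be positive.\<close>

lemma weights_to_list:
  fixes p :: "'b set \<Rightarrow> real"
  assumes "finite G" "\<And>T. T \<in> G \<Longrightarrow> 0 \<le> p T"
  shows "\<exists>ps. (\<forall>(r, T)\<in>set ps. 0 < r \<and> T \<in> G) \<and> sum_list (map fst ps) = sum p G \<and>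
    (\<forall>e. (\<Sum>(r, T)\<leftarrow>ps. r * indicator T e) = (\<Sum>T\<in>G. p T * indicator T e))"
  using assms
proof (induction G rule: finite_induct)
  case empty
  show ?case by (rule exI[of _ "[]"]) simp
next
  case (insert T G)
  then obtain ps where ps: "\<forall>(r, T)\<in>set ps. 0 < r \<and> T \<in> G" "sum_list (map fst ps) = sum p G"
    "\<forall>e. (\<Sum>(r, T)\<leftarrow>ps. r * indicator T e) = (\<Sum>T\<in>G. p T * indicator T e)"
    by auto
  show ?case
    unfolding sum.insert[OF insert.hyps]
  proof (cases "p T = 0")
    case True
    then show "\<exists>ps. (\<forall>(r, T')\<in>set ps. 0 < r \<and> T' \<in> insert T G) \<and> sum_list (map fst ps) = p T + sum p G \<and>
      (\<forall>e. (\<Sum>(r, T)\<leftarrow>ps. r * indicator T e) = p T * indicator T e + (\<Sum>T\<in>G. p T * indicator T e))"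
      using ps by (intro exI[of _ ps]) auto
  next
    case False
    moreover have "p T \<ge> 0" using insert.prems by simp
    ultimately show "\<exists>ps. (\<forall>(r, T')\<in>set ps. 0 < r \<and> T' \<in> insert T G) \<and> sum_list (map fst ps) = p T + sum p G \<and>
      (\<forall>e. (\<Sum>(r, T)\<leftarrow>ps. r * indicator T e) = p T * indicator T e + (\<Sum>T\<in>G. p T * indicator T e))"
      using ps by (intro exI[of _ "(p T, T) # ps"]) auto
  qed
qed

text \<open>The list fixes an order of the trees, and the prefix \<open>as\<close> stands for the
  first \<open>k\<close> trees that a narrow cut asks for.\<close>

definition layered :: "'a set \<Rightarrow> 'a set set \<Rightarrow> ('a set \<Rightarrow> real) \<Rightarrow> (real \<times> 'a set set) list \<Rightarrow> bool" where
  "layered V L x ps \<longleftrightarrow> (\<forall>(r, T)\<in>set ps. 0 < r \<and> is_tree V T) \<and> sum_list (map fst ps) = 1 \<and>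
    (\<forall>e\<in>complete_edges V. x e = (\<Sum>(r, T)\<leftarrow>ps. r * indicator T e)) \<and>
    (\<forall>X\<in>L. \<exists>as bs. ps = as @ bs \<and> 2 - sum x (cut V X) \<le> sum_list (map fst as) \<and>
      (\<forall>(r, T)\<in>set as. card (cut V X \<inter> T) = 1))"

definition scale :: "real \<Rightarrow> (real \<times> 'b) list \<Rightarrow> (real \<times> 'b) list" where
  "scale c = map (\<lambda>(r, T). (c * r, T))"

lemma sum_list_scale: "sum_list (map fst (scale c ps)) = c * sum_list (map fst ps)"
  by (induction ps) (auto simp: scale_def algebra_simps)

lemma sum_list_scale_indicator:
  "(\<Sum>(r, T)\<leftarrow>scale c ps. r * indicator T e) = c * (\<Sum>(r, T)\<leftarrow>ps. r * (indicator T e :: real))"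
  by (induction ps) (auto simp: scale_def algebra_simps)

lemma scale_append: "scale c (as @ bs) = scale c as @ scale c bs"
  by (simp add: scale_def)

text \<open>The single-crossing trees come first in the list and belong to the prefix of every cut;
  a cut that needs more weight continues with a prefix of the list for the remainder
  \<open>z\<close>.\<close>

lemma layered_exists:
  assumes "balanced_point V L x" "\<And>X. X \<in> L \<Longrightarrow> sum x (cut V X) < 2"
  shows "\<exists>ps. layered V L x ps"
  using assms
proof (induction "card L" arbitrary: L x rule: less_induct)
  case less
  interpret balanced_point V L x by (rule less.prems)
  let ?E = "complete_edges V"
  let ?f = "\<lambda>X. 2 - sum x (cut V X)"
  \<comment> \<open>For an empty chain the value 1 puts all the weight on one layer, which ends the
    recursion.\<close>
  define lam where "lam = (if L = {} then 1 else Min (?f ` L))"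
  have cut_ge: "1 \<le> sum x (cut V X)" if "X \<in> L" for X
  proof -
    have "X \<subseteq> V" "X \<noteq> {}" "V - X \<noteq> {}" using proper[OF that] by auto
    then have "1 \<le> deficit x X" "1 \<le> deficit x (V - X)" using deficit_ge by auto
    then show ?thesis using sum_cut[OF \<open>X \<subseteq> V\<close>] by linarith
  qed
  have lam_le: "lam \<le> ?f X" if "X \<in> L" for X
    using that finite_L by (auto simp: lam_def)
  have lam_in: "lam \<in> ?f ` L" if "L \<noteq> {}"
    using that finite_L by (simp add: lam_def)
  have lam_pos: "0 < lam" "lam \<le> 1"
    using lam_in less.prems(2) cut_ge by (cases "L = {}"; force simp: lam_def)+
  interpret slack_point V L x lam
  proof
    show "sum x (cut V X) \<le> 2 - lam" if "X \<in> L" for X using lam_le[OF that] by linarith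
  qed (use lam_pos in auto)
  have fG: "finite single_crossing_trees" using finite_trees single_crossing_subset finite_subset by blast
  obtain p q where p: "\<And>T. T \<in> single_crossing_trees \<Longrightarrow> 0 \<le> p T" "sum p single_crossing_trees = 1"
    and q: "\<And>T. T \<in> trees \<Longrightarrow> 0 \<le> q T" "sum q trees = 1"
    and xpq: "\<And>e. e \<in> ?E \<Longrightarrow> x e = lam * (\<Sum>T\<in>single_crossing_trees. p T * indicator T e)
      + (1 - lam) * (\<Sum>T\<in>trees. q T * indicator T e)"
    using split_into_trees by blast
  obtain ps where ps: "\<forall>(r, T)\<in>set ps. 0 < r \<and> T \<in> single_crossing_trees" "sum_list (map fst ps) = 1"
    "\<forall>e. (\<Sum>(r, T)\<leftarrow>ps. r * indicator T e) = (\<Sum>T\<in>single_crossing_trees. p T * indicator T e)"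
    using weights_to_list[of single_crossing_trees p] fG p by auto
  have ps_tree: "0 < r" "is_tree V T" if "(r, T) \<in> set ps" for r T
    using ps(1) that by (auto simp: single_crossing_trees_def)
  have ps_cross: "card (cut V X \<inter> T) = 1" if "(r, T) \<in> set ps" "X \<in> L" for r T X
    using ps(1) that by (auto simp: single_crossing_trees_def)
  show ?case
  proof (cases "lam = 1")
    case True
    \<comment> \<open>Every cut of the chain has weight at least 1, so the whole list of total
      weight 1 serves as its prefix.\<close>
    have "layered V L x ps"
      unfolding layered_def
    proof (intro conjI ballI)
      fix X assume "X \<in> L"
      then show "\<exists>as bs. ps = as @ bs \<and> ?f X \<le> sum_list (map fst as) \<and>
        (\<forall>(r, T)\<in>set as. card (cut V X \<inter> T) = 1)"
        using ps(2) cut_ge ps_cross by (intro exI[of _ ps] exI[of _ "[]"]) auto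
    qed (use ps ps_tree xpq True in auto)
    then show ?thesis by blast
  next
    case False
    then have lam1: "lam < 1" using lam_pos by simp
    define y where "y e = (\<Sum>T\<in>single_crossing_trees. p T * indicator T e)" for e
    define z where "z e = (\<Sum>T\<in>trees. q T * indicator T e)" for e
    define L' where "L' = {X \<in> L. lam < ?f X}"
    have ysum: "sum y A = (\<Sum>T\<in>single_crossing_trees. p T * real (card (T \<inter> A)))"
      and zsum: "sum z A = (\<Sum>T\<in>trees. q T * real (card (T \<inter> A)))"
      and xsum: "sum x A = lam * sum y A + (1 - lam) * sum z A" if "A \<subseteq> ?E" for A
    proof -
      have fA: "finite A" using finite_edges that .
      show "sum y A = (\<Sum>T\<in>single_crossing_trees. p T * real (card (T \<inter> A)))"
        "sum z A = (\<Sum>T\<in>trees. q T * real (card (T \<inter> A)))"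
        unfolding y_def z_def by (rule sum_mixture[OF fA])+
      have "sum x A = (\<Sum>e\<in>A. lam * y e + (1 - lam) * z e)"
        using xpq that by (intro sum.cong) (auto simp: y_def z_def)
      then show "sum x A = lam * sum y A + (1 - lam) * sum z A"
        by (simp add: sum.distrib sum_distrib_left)
    qed
    have yconst: "sum y A = real k" if "A \<subseteq> ?E" "\<And>T. T \<in> single_crossing_trees \<Longrightarrow> card (T \<inter> A) = k" for A k
      using ysum[OF that(1)] that(2) p(2) by (simp add: sum_distrib_right[symmetric])
    have EU: "complete_edges U \<subseteq> ?E" if "U \<subseteq> V" for U using that by (rule complete_edges_mono)
    have bal: "balanced_point V L' z"
    proof
      show "finite V" "V \<noteq> {}" by (rule finite_V V_nonempty)+
      show "X \<noteq> {} \<and> X \<subset> V" if "X \<in> L'" for X using that proper by (auto simp: L'_def)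
      show "X \<subseteq> Y \<or> Y \<subseteq> X" if "X \<in> L'" "Y \<in> L'" for X Y using that chain by (auto simp: L'_def)
      show "0 \<le> z e" for e unfolding z_def using q by (intro sum_nonneg) auto
      have tree_in: "real (card (T \<inter> ?E)) = real (card V) - 1" if "T \<in> trees" for T
        using that by (auto simp: trees_def is_tree_def Int_absorb2)
      have "sum z ?E = (\<Sum>T\<in>trees. q T * (real (card V) - 1))"
        using zsum[OF order_refl] tree_in by simp
      also have "\<dots> = real (card V) - 1" using q(2) by (simp add: sum_distrib_right[symmetric])
      finally show "deficit z V = 1" by (simp add: deficit_def)
      show "1 \<le> deficit z U" if "U \<subseteq> V" "U \<noteq> {}" for U
      proof -
        have "sum z (complete_edges U) \<le> (\<Sum>T\<in>trees. q T * (real (card U) - 1))"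
          unfolding zsum[OF EU[OF that(1)]]
        proof (intro sum_mono mult_left_mono)
          fix T assume T: "T \<in> trees"
          then have "card (T \<inter> complete_edges U) + 1 \<le> card U"
            using tree_card_complete[OF finite_V _ that] by (simp add: trees_def)
          then show "real (card (T \<inter> complete_edges U)) \<le> real (card U) - 1" by linarith
        qed (use q in auto)
        also have "\<dots> = real (card U) - 1" using q(2) by (simp add: sum_distrib_right[symmetric])
        finally show ?thesis by (simp add: deficit_def)
      qed
      \<comment> \<open>Both sides have deficit 1 in \<open>y\<close> and equal deficits in
        \<open>x\<close>, hence equal deficits in the remainder.\<close>
      show "deficit z X = deficit z (V - X)" if "X \<in> L'" for X
      proof -
        have X: "X \<in> L" "X \<subseteq> V" using that proper by (auto simp: L'_def)
        have mix: "deficit x U = lam * deficit y U + (1 - lam) * deficit z U" if "U \<subseteq> V" for U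
          using xsum[OF EU[OF that]] by (simp add: deficit_def algebra_simps)
        have "card (T \<inter> complete_edges X) = card X - 1"
          "card (T \<inter> complete_edges (V - X)) = card (V - X) - 1" if "T \<in> single_crossing_trees" for T
          using single_crossing_card[OF that X(1)] by linarith+
        then have "sum y (complete_edges X) = real (card X - 1)"
          "sum y (complete_edges (V - X)) = real (card (V - X) - 1)"
          using X by (intro yconst EU; auto)+
        moreover have "card X \<ge> 1" "card (V - X) \<ge> 1"
          using proper[OF X(1)] finite_V by (auto simp: Suc_le_eq card_gt_0_iff intro: finite_subset)
        ultimately have "deficit y X = 1" "deficit y (V - X) = 1"
          by (simp_all add: deficit_def)
        then have "(1 - lam) * deficit z X = (1 - lam) * deficit z (V - X)"
          using mix[of X] mix[of "V - X"] balanced[OF X(1)] X by auto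
        then show ?thesis using lam1 by simp
      qed
    qed
    have zcut: "(1 - lam) * sum z (cut V X) = sum x (cut V X) - lam" if "X \<in> L" for X
    proof -
      have "cut V X \<subseteq> ?E" by (auto simp: cut_def)
      moreover have "sum y (cut V X) = real 1"
        using calculation that by (intro yconst) (auto simp: single_crossing_trees_def Int_commute)
      ultimately show ?thesis using xsum[of "cut V X"] by simp
    qed
    have zlt: "sum z (cut V X) < 2" if "X \<in> L'" for X
    proof -
      have "(1 - lam) * sum z (cut V X) < (1 - lam) * 2"
        using that zcut[of X] by (auto simp: L'_def)
      moreover have "0 < 1 - lam" using lam1 by simp
      ultimately show ?thesis by (metis mult_less_cancel_left_pos)
    qed
    \<comment> \<open>The minimum defining \<open>lam\<close> is attained, and the set attaining it
      leaves the chain.\<close>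
    have "L \<noteq> {}" using False by (auto simp: lam_def)
    then obtain X0 where "X0 \<in> L" "lam = ?f X0" using lam_in by auto
    then have "L' \<subset> L" by (auto simp: L'_def)
    then have "card L' < card L" using finite_L by (rule psubset_card_mono[rotated])
    then obtain qs where qs: "layered V L' z qs" using less.hyps[OF _ bal zlt] by blast
    have "layered V L x (scale lam ps @ scale (1 - lam) qs)" (is "layered V L x ?rs")
      unfolding layered_def
    proof (intro conjI ballI)
      show "case rT of (r, T) \<Rightarrow> 0 < r \<and> is_tree V T" if rT: "rT \<in> set ?rs" for rT
      proof -
        consider r T where "(r, T) \<in> set ps" "rT = (lam * r, T)"
          | r T where "(r, T) \<in> set qs" "rT = ((1 - lam) * r, T)"
          using rT by (auto simp: scale_def)
        then show ?thesis
        proof cases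
          case 1
          then show ?thesis using ps_tree lam_pos by auto
        next
          case 2
          then have "0 < r \<and> is_tree V T" using qs by (auto simp: layered_def)
          then show ?thesis using 2 lam1 by simp
        qed
      qed
      show "sum_list (map fst ?rs) = 1"
        using ps(2) qs by (simp add: sum_list_scale layered_def)
      show "x e = (\<Sum>(r, T)\<leftarrow>?rs. r * indicator T e)" if "e \<in> ?E" for e
      proof -
        have "z e = (\<Sum>(r, T)\<leftarrow>qs. r * indicator T e)" using qs that by (simp add: layered_def)
        then show ?thesis using xpq[OF that] ps(3) by (simp add: sum_list_scale_indicator z_def)
      qed
      fix X assume X: "X \<in> L"
      show "\<exists>as bs. ?rs = as @ bs \<and> ?f X \<le> sum_list (map fst as) \<and>
        (\<forall>(r, T)\<in>set as. card (cut V X \<inter> T) = 1)"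
      proof (cases "X \<in> L'")
        case True
        then obtain as bs where as: "qs = as @ bs" "2 - sum z (cut V X) \<le> sum_list (map fst as)"
          "\<forall>(r, T)\<in>set as. card (cut V X \<inter> T) = 1"
          using qs unfolding layered_def by blast
        \<comment> \<open>Since \<open>y\<close> has weight 1 on the cut, what remains to be covered
          after the first layer is the requirement for \<open>z\<close>, scaled by
          \<open>1 - lam\<close>.\<close>
        have "?f X = lam + (1 - lam) * (2 - sum z (cut V X))"
          using zcut[OF X] by (simp add: algebra_simps)
        also have "\<dots> \<le> lam + (1 - lam) * sum_list (map fst as)"
          using as(2) lam1 by (intro add_left_mono mult_left_mono) auto
        also have "\<dots> = sum_list (map fst (scale lam ps @ scale (1 - lam) as))"
          using ps(2) by (simp add: sum_list_scale)
        finally have "?f X \<le> sum_list (map fst (scale lam ps @ scale (1 - lam) as))" .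
        moreover have "\<forall>(r, T)\<in>set (scale lam ps @ scale (1 - lam) as). card (cut V X \<inter> T) = 1"
          using as(3) ps_cross X by (auto simp: scale_def)
        ultimately show ?thesis
          by (intro exI[of _ "scale lam ps @ scale (1 - lam) as"] exI[of _ "scale (1 - lam) bs"])
            (simp add: as(1) scale_append)
      next
        case False
        then have "?f X \<le> sum_list (map fst (scale lam ps))"
          using X ps(2) by (simp add: sum_list_scale L'_def)
        moreover have "\<forall>(r, T)\<in>set (scale lam ps). card (cut V X \<inter> T) = 1"
          using ps_cross X by (auto simp: scale_def)
        ultimately show ?thesis by blast
      qed
    qed
    then show ?thesis by blast
  qed
qed

section \<open>Feasible points of the linear program\<close>

lemma sum_cut_eq:
  fixes x :: "'a set \<Rightarrow> real"
  assumes "finite V"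
  shows "sum x (cut V U) = (\<Sum>e\<in>complete_edges V. if card (e \<inter> U) = 1 then x e else 0)"
  unfolding cut_def using finite_complete_edges[OF assms] by (rule sum.inter_filter)

text \<open>Handshake count: an edge inside \<open>U\<close> is met at both ends, an edge of the cut
  at one.\<close>

lemma sum_degrees:
  fixes x :: "'a set \<Rightarrow> real"
  assumes "finite V" "U \<subseteq> V"
  shows "(\<Sum>v\<in>U. sum x (cut V {v})) = 2 * sum x (complete_edges U) + sum x (cut V U)"
proof -
  let ?E = "complete_edges V"
  have fE: "finite ?E" using finite_complete_edges assms by blast
  have fU: "finite U" using assms finite_subset by blast
  have "(\<Sum>v\<in>U. sum x (cut V {v})) = (\<Sum>e\<in>?E. \<Sum>v\<in>U. if card (e \<inter> {v}) = 1 then x e else 0)"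
    unfolding sum_cut_eq[OF assms(1)] by (rule sum.swap)
  also have "\<dots> = (\<Sum>e\<in>?E. 2 * (if e \<in> complete_edges U then x e else 0) + (if card (e \<inter> U) = 1 then x e else 0))"
  proof (rule sum.cong)
    fix e assume "e \<in> ?E"
    then obtain a b where ab: "e = {a, b}" "a \<in> V" "b \<in> V" "a \<noteq> b" by (rule complete_edgesE)
    have "(\<Sum>v\<in>U. if card (e \<inter> {v}) = 1 then x e else 0) = (\<Sum>v\<in>U. (if v = a then x e else 0) + (if v = b then x e else 0))"
      by (rule sum.cong) (use ab card_pair_Int in auto)
    also have "\<dots> = (if a \<in> U then x e else 0) + (if b \<in> U then x e else 0)"
      using fU by (simp add: sum.distrib)
    also have "\<dots> = 2 * (if e \<in> complete_edges U then x e else 0) + (if card (e \<inter> U) = 1 then x e else 0)"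
      using ab card_pair_Int[of a b U] by (auto simp: complete_edges_iff)
    finally show "(\<Sum>v\<in>U. if card (e \<inter> {v}) = 1 then x e else 0) = \<dots>" .
  qed simp
  also have "\<dots> = 2 * (\<Sum>e\<in>?E. if e \<in> complete_edges U then x e else 0) + sum x (cut V U)"
    unfolding sum_cut_eq[OF assms(1)] by (simp add: sum.distrib sum_distrib_left)
  also have "(\<Sum>e\<in>?E. if e \<in> complete_edges U then x e else 0) = sum x (complete_edges U)"
    using complete_edges_mono[OF assms(2)] fE by (simp add: sum.inter_restrict[symmetric] Int_absorb1)
  finally show ?thesis .
qed

lemma cut_complement:
  assumes "U \<subseteq> V"
  shows "cut V (V - U) = cut V U"
proof -
  have "card (e \<inter> (V - U)) = 1 \<longleftrightarrow> card (e \<inter> U) = 1" if "e \<in> complete_edges V" for e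
  proof -
    obtain a b where "e = {a, b}" "a \<in> V" "b \<in> V" "a \<noteq> b" using \<open>e \<in> _\<close> by (rule complete_edgesE)
    then show ?thesis by (auto simp: card_pair_Int)
  qed
  then show ?thesis by (auto simp: cut_def)
qed

text \<open>An edge crossing one of the differences crosses one of the sets, and an edge crossing
  both differences runs between them and crosses both sets.\<close>

lemma sum_cut_uncross:
  fixes x :: "'a set \<Rightarrow> real"
  assumes "finite V" "\<And>e. e \<in> complete_edges V \<Longrightarrow> 0 \<le> x e"
  shows "sum x (cut V (X - Y)) + sum x (cut V (Y - X)) \<le> sum x (cut V X) + sum x (cut V Y)"
  unfolding sum_cut_eq[OF assms(1)] sum.distrib[symmetric]
proof (rule sum_mono)
  fix e assume e: "e \<in> complete_edges V"
  then obtain a b where "e = {a, b}" "a \<in> V" "b \<in> V" "a \<noteq> b" by (rule complete_edgesE)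
  then show "(if card (e \<inter> (X - Y)) = 1 then x e else 0) + (if card (e \<inter> (Y - X)) = 1 then x e else 0)
    \<le> (if card (e \<inter> X) = 1 then x e else 0) + (if card (e \<inter> Y) = 1 then x e else 0)"
    using assms(2)[OF e] by (auto simp: card_pair_Int)
qed

definition narrow_chain :: "'a set \<Rightarrow> 'a \<Rightarrow> 'a \<Rightarrow> ('a set \<Rightarrow> real) \<Rightarrow> 'a set set" where
  "narrow_chain V s t x = {X. X \<subseteq> V \<and> s \<in> X \<and> t \<notin> X \<and> sum x (cut V X) < 2}"

text \<open>Even sets have cuts of weight at least 2, so a narrow cut separates \<open>s\<close>
  from \<open>t\<close>, and one of its two sides contains \<open>s\<close>.\<close>

lemma narrow_cut_in_chain:
  assumes "lp_feasible V s t x" "C \<in> narrow_cuts V x" "s \<noteq> t" "s \<in> V" "t \<in> V"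
  obtains X where "X \<in> narrow_chain V s t x" "C = cut V X"
proof -
  obtain U where U: "C = cut V U" "U \<noteq> {}" "U \<subset> V" "sum x (cut V U) < 2"
    using assms(2) by (auto simp: narrow_cuts_def)
  have "odd (card (U \<inter> {s, t}))"
    using assms(1) U unfolding lp_feasible_def by (meson not_le)
  then have "(s \<in> U) \<noteq> (t \<in> U)" using assms(3) by (cases "s \<in> U"; cases "t \<in> U") auto
  then consider "s \<in> U" "t \<notin> U" | "s \<notin> U" "t \<in> U" by blast
  then show ?thesis
  proof cases
    case 1
    then show ?thesis using U that[of U] by (auto simp: narrow_chain_def)
  next
    case 2
    then show ?thesis using U that[of "V - U"] cut_complement[of U V] assms by (auto simp: narrow_chain_def)
  qed
qed

text \<open>Summing the degree equations over \<open>U\<close> expresses \<open>deficit x U\<close>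
  as half of \<open>card (U \<inter> {s, t})\<close> plus the cut weight, from which the bounds and
  the balance are read off.\<close>

lemma lp_feasible_balanced:
  assumes V: "finite V" "s \<in> V" "t \<in> V" "s \<noteq> t" and lp: "lp_feasible V s t x"
  shows "balanced_point V (narrow_chain V s t x) x"
proof -
  have nonneg: "0 \<le> x e" if "e \<in> complete_edges V" for e using lp that by (simp add: lp_feasible_def)
  have even_ge: "2 \<le> sum x (cut V U)" if "U \<noteq> {}" "U \<subset> V" "even (card (U \<inter> {s, t}))" for U
    using lp that by (simp add: lp_feasible_def)
  have odd_ge: "1 \<le> sum x (cut V U)" if "U \<noteq> {}" "U \<subset> V" "odd (card (U \<inter> {s, t}))" for U
    using lp that by (simp add: lp_feasible_def)
  have def: "deficit x U = (real (card (U \<inter> {s, t})) + sum x (cut V U)) / 2" if U: "U \<subseteq> V" for U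
  proof -
    have fU: "finite U" using U V finite_subset by blast
    have "sum x (cut V {v}) = 2 - indicator {s, t} v" if "v \<in> U" for v
      using lp U that unfolding lp_feasible_def by (cases "v \<in> {s, t}") auto
    then have "(\<Sum>v\<in>U. sum x (cut V {v})) = (\<Sum>v\<in>U. 2 - indicator {s, t} v)" by simp
    also have "\<dots> = 2 * real (card U) - real (card (U \<inter> {s, t}))"
      using fU by (simp add: sum_subtractf sum_inter_indicator Int_commute)
    finally show ?thesis using sum_degrees[OF V(1) U, of x] by (simp add: deficit_def)
  qed
  show ?thesis
  proof
    show "finite V" "V \<noteq> {}" using V by auto
    show "X \<noteq> {} \<and> X \<subset> V" if "X \<in> narrow_chain V s t x" for X
      using that V by (auto simp: narrow_chain_def)
    \<comment> \<open>For incomparable sets both differences avoid \<open>s\<close> and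
      \<open>t\<close>, so their cuts weigh at least 2 each; uncrossing contradicts this, as the
      cuts of \<open>X\<close> and \<open>Y\<close> weigh less than 2.\<close>
    show "X \<subseteq> Y \<or> Y \<subseteq> X" if X: "X \<in> narrow_chain V s t x" and Y: "Y \<in> narrow_chain V s t x" for X Y
    proof (rule ccontr)
      assume "\<not> ?thesis"
      then have "X - Y \<noteq> {}" "Y - X \<noteq> {}" by auto
      moreover have "(X - Y) \<inter> {s, t} = {}" "(Y - X) \<inter> {s, t} = {}" "X - Y \<subset> V" "Y - X \<subset> V"
        using X Y V by (auto simp: narrow_chain_def)
      ultimately have "2 \<le> sum x (cut V (X - Y))" "2 \<le> sum x (cut V (Y - X))"
        by (intro even_ge; simp)+
      moreover have "sum x (cut V (X - Y)) + sum x (cut V (Y - X)) \<le> sum x (cut V X) + sum x (cut V Y)"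
        using V(1) nonneg by (rule sum_cut_uncross)
      ultimately show False using X Y by (simp add: narrow_chain_def)
    qed
    show "0 \<le> x e" if "e \<in> complete_edges V" for e using nonneg that .
    have "cut V V = {}" by (auto simp: cut_def complete_edges_def Int_absorb2)
    moreover have "V \<inter> {s, t} = {s, t}" using V by auto
    ultimately show V1: "deficit x V = 1" using def[of V] V by simp
    show "1 \<le> deficit x U" if U: "U \<subseteq> V" "U \<noteq> {}" for U
    proof (cases "U = V")
      case False
      then have "U \<subset> V" using U by auto
      then show ?thesis
        using def[OF U(1)] even_ge[OF U(2)] odd_ge[OF U(2)]
        by (cases "even (card (U \<inter> {s, t}))") (auto elim!: oddE)
    qed (use V1 in simp)
    show "deficit x X = deficit x (V - X)" if "X \<in> narrow_chain V s t x" for X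
    proof -
      have X: "X \<subseteq> V" "s \<in> X" "t \<notin> X" using that by (auto simp: narrow_chain_def)
      then have "X \<inter> {s, t} = {s}" "(V - X) \<inter> {s, t} = {t}" using V by auto
      then show ?thesis using def[of X] def[of "V - X"] cut_complement[OF X(1)] X by simp
    qed
  qed
qed

section \<open>From the weighted list to the indexed family of trees\<close>

lemma sum_nth_take:
  fixes f :: "'b \<Rightarrow> real"
  assumes "k \<le> length ps"
  shows "(\<Sum>j=1..k. f (ps ! (j - 1))) = sum_list (map f (take k ps))"
proof -
  have "(\<Sum>j=1..k. f (ps ! (j - 1))) = (\<Sum>j<k. f (ps ! j))"
    by (rule sum.reindex_bij_witness[of _ Suc "\<lambda>j. j - 1"]) auto
  also have "\<dots> = sum_list (map f (take k ps))"
    using assms by (simp add: sum_list_sum_nth atLeast0LessThan)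
  finally show ?thesis .
qed

theorem theorem3:
  fixes V :: "'a set" and s t :: 'a and x :: "'a set \<Rightarrow> real"
  assumes "finite V" and "s \<in> V" and "t \<in> V" and "s \<noteq> t"
    and "lp_feasible V s t x"
  shows "\<exists>(r::nat) (S :: nat \<Rightarrow> 'a set set) (p :: nat \<Rightarrow> real).
    (\<forall>j\<in>{1..r}. S j \<in> spanning_trees V \<and> p j > 0) \<and>
    (\<Sum>j=1..r. p j) = 1 \<and>
    (\<forall>e\<in>complete_edges V. x e = (\<Sum>j=1..r. p j * indicator (S j) e)) \<and>
    (\<forall>C\<in>narrow_cuts V x. \<exists>k\<in>{1..r}.
       (\<Sum>j=1..k. p j) \<ge> 2 - sum x C \<and> (\<forall>j\<in>{1..k}. card (C \<inter> S j) = 1))"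
proof -
  let ?L = "narrow_chain V s t x"
  have "\<exists>ps. layered V ?L x ps"
    using lp_feasible_balanced[OF assms] by (rule layered_exists) (simp add: narrow_chain_def)
  then obtain ps where ps: "layered V ?L x ps" by blast
  \<comment> \<open>Lists are indexed from 0, the family of trees from 1.\<close>
  define S where "S j = snd (ps ! (j - 1))" for j
  define p where "p j = fst (ps ! (j - 1))" for j
  let ?r = "length ps"
  have mem: "(p j, S j) \<in> set (take k ps)" if "j \<in> {1..k}" "k \<le> ?r" for j k
  proof -
    have "take k ps ! (j - 1) \<in> set (take k ps)" using that by (intro nth_mem) auto
    moreover have "take k ps ! (j - 1) = ps ! (j - 1)" using that by (intro nth_take) auto
    ultimately show ?thesis by (simp add: p_def S_def)
  qed
  have psum: "(\<Sum>j=1..k. p j) = sum_list (map fst (take k ps))" if "k \<le> ?r" for k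
    unfolding p_def using sum_nth_take[OF that, of fst] .
  show ?thesis
  proof (intro exI[of _ ?r] exI[of _ S] exI[of _ p] conjI ballI)
    fix j assume "j \<in> {1..?r}"
    then have "0 < p j \<and> is_tree V (S j)" using mem[of j ?r] ps by (auto simp: layered_def)
    then show "S j \<in> spanning_trees V" "p j > 0"
      using is_tree_imp_spanning_tree assms(1) by auto
  next
    show "(\<Sum>j=1..?r. p j) = 1" using psum[of ?r] ps by (simp add: layered_def)
  next
    fix e assume "e \<in> complete_edges V"
    then have "x e = (\<Sum>(r, T)\<leftarrow>ps. r * indicator T e)" using ps by (simp add: layered_def)
    also have "\<dots> = (\<Sum>j=1..?r. case ps ! (j - 1) of (r, T) \<Rightarrow> r * indicator T e)"
      using sum_nth_take[of ?r ps "\<lambda>(r, T). r * indicator T e"] by simp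
    finally show "x e = (\<Sum>j=1..?r. p j * indicator (S j) e)" by (simp add: p_def S_def split_def)
  next
    fix C assume C: "C \<in> narrow_cuts V x"
    obtain X where X: "X \<in> ?L" "C = cut V X"
      using narrow_cut_in_chain[OF assms(5) C assms(4,2,3)] by blast
    then obtain as bs where as: "ps = as @ bs" "2 - sum x C \<le> sum_list (map fst as)"
      "\<forall>(r, T)\<in>set as. card (C \<inter> T) = 1"
      using ps unfolding layered_def by blast
    let ?k = "length as"
    have k: "take ?k ps = as" "?k \<le> ?r" using as(1) by auto
    \<comment> \<open>A narrow cut requires positive weight, so its prefix is not empty and
      \<open>k\<close> is at least 1.\<close>
    have "as \<noteq> []" using as(2) X by (auto simp: narrow_chain_def)
    then have "1 \<le> ?k" by (simp add: Suc_le_eq)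
    moreover have "card (C \<inter> S j) = 1" if "j \<in> {1..?k}" for j
      using mem[OF that k(2)] as(3) k(1) by auto
    moreover have "2 - sum x C \<le> (\<Sum>j=1..?k. p j)" using as(2) psum[OF k(2)] k(1) by simp
    ultimately show "\<exists>k\<in>{1..?r}. (\<Sum>j=1..k. p j) \<ge> 2 - sum x C \<and> (\<forall>j\<in>{1..k}. card (C \<inter> S j) = 1)"
      using k(2) by (intro bexI[of _ ?k]) auto
  qed
qed

end
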